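(* Let $n \geq 21$ and let $K$ be a field. Given a degree $n$ polynomial $$p(x) = x^n+a_1x^{n-1}+\ldots+a_{n-1}x+a_n \in K[x],$$ one can find a Tschirnhaus transformation $$T(x) = b_{n-1}x^{n-1}+b_{n-2}x^{n-2}+\ldots+b_1x+b_0,$$ with $(b_0,\ldots,b_{n-1})$ not identically zero, such that after setting $y = T(x)$ the transformed polynomial $$q(y) = y^n+A_1y^{n-1}+\ldots+A_{n-1}y+A_{n}$$ satisfies $A_1 = A_2 = A_3 = A_4 = A_5 = 0$. Moreover, the coefficients $b_0, \ldots, b_{n-1}$ of $T$ can be determined by solving equations of degree at most $20$.
   Context: Let $p(x)=x^n+a_1x^{n-1}+\ldots+a_n=\prod_{i=1}^n(x-x_i)$ be a monic polynomial over a (not necessarily algebraically closed) field $K$, with roots $x_1,\ldots,x_n\in\overline{K}$ listed with multiplicity. A Tschirnhaus transformation is a polynomial $T(x)=b_{n-1}x^{n-1}+\ldots+b_1x+b_0\in L[x]$, where $L$ is an algebraic extension of $K$. Applying it to the roots of $p$ (that is, "setting $y=T(x)$") gives the transformed polynomial $$q(y)=\prod_{i=1}^n\bigl(y-T(x_i)\bigr)=y^n+A_1y^{n-1}+\ldots+A_{n-1}y+A_n\in L[y].$$ Each $A_i$ is a polynomial in $a_1,\ldots,a_n,b_0,\ldots,b_{n-1}$, homogeneous of degree $i$ in $b_0,\ldots,b_{n-1}$. The coefficient vector $(b_0,\ldots,b_{n-1})$ is regarded as a point of $\mathbb{P}^{n-1}$. Quantities can be "determined by solving equations of degree at most $d$"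 if they lie in a field $L$ at the top of a finite tower $K=K_0\subset K_1\subset\cdots\subset K_r=L$, where each $K_{j+1}$ is obtained from $K_j$ by adjoining a root of a polynomial of degree at most $d$ with coefficients in $K_j$. *)

theory Defs
  imports
    "HOL-Algebra.Algebraic_Closure_Type"
    "HOL-Algebra.Generated_Fields"
    "HOL-Computational_Algebra.Polynomial"
begin

text \<open>
  Subfields of a field given as a type are sets of elements of that type, and
  \<open>generate_field ring_of_type_algebra (insert a L)\<close> is the extension \<open>L(a)\<close>.
  Below, \<open>solvable_tower d K L\<close> says that there is a finite tower
  \<open>K = K\<^sub>0 \<subseteq> \<dots> \<subseteq> K\<^sub>r = L\<close> (possibly with \<open>r = 0\<close>) in which each step adjoins a root of a
  nonzero polynomial of degree at most \<open>d\<close>, not assumed irreducible, over the preceding field.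
\<close>

inductive solvable_tower :: "nat \<Rightarrow> 'a::field set \<Rightarrow> 'a set \<Rightarrow> bool"
  for d :: nat and K :: "'a set" where
  base: "solvable_tower d K K"
| adjoin:
    "\<lbrakk>solvable_tower d K L; f \<noteq> 0; Polynomial.degree f \<le> d; range (Polynomial.coeff f) \<subseteq> L;
      poly f a = 0\<rbrakk>
     \<Longrightarrow> solvable_tower d K (generate_field ring_of_type_algebra (insert a L))"

text \<open>
  The roots \<open>x\<^sub>i\<close> are taken in the algebraic closure of the field, with multiplicity.
  The definition is intended for monic \<open>p\<close>; the leading coefficient is otherwise ignored.
\<close>

definition tschirnhaus ::
  "'a::field alg_closure poly \<Rightarrow> 'a poly \<Rightarrow> 'a alg_closure poly" where
  "tschirnhaus T p = (\<Prod>x\<in>#proots (map_poly to_ac p). [:- poly T x, 1:])"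

end

theory Submission
  imports Defs "Jordan_Normal_Form.Char_Poly"
begin

text \<open>
  Let \<open>F\<close> be the union of all fields in the algebraic closure that are reached by towers with steps of
  degree at most 20. It is a field in which every nonconstant polynomial of degree at most 20 has a
  root, and the finitely many coefficients of a polynomial over \<open>F\<close> lie in a single tower. So it suffices
  to find the transformation \<open>T\<close> over \<open>F\<close>.

  For \<open>T\<close> in the \<open>n\<close>-dimensional space of polynomials over \<open>F\<close> of degree less than \<open>n\<close>, the coefficient
  \<open>A\<^sub>i\<close> of the transformed polynomial is a form of degree \<open>i\<close> in \<open>T\<close>, by \<open>form_coeff_prod\<close>, and it
  takes values in \<open>F\<close>, by \<open>coeff_prod_roots_in_range\<close>. What is needed is a nontrivial common zero of
  forms of degrees 1 to 5. Eliminating directly leads to degree \<open>5! = 120\<close>, but the number of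
  variables is large, and Sylvester's method of obliteration trades variables for degree. If \<open>a\<close> is a
  common zero of some forms, then a form \<open>g\<close> of degree \<open>d\<close> expands as
  \<open>g(sa + w) = \<Sum>\<^sub>i s\<^sup>d\<^sup>-\<^sup>i h\<^sub>i(w)\<close>, where the polar \<open>h\<^sub>i\<close> has degree \<open>i\<close> and \<open>h\<^sub>0 = g(a) = 0\<close>. The
  common zeros of all polars hence extend \<open>a\<close> to larger linear spaces of common zeros
  (\<open>solvable_obliterate\<close>). A form of degree at most 20 restricted to a 2-dimensional space of zeros of
  the other forms is solved as a polynomial in one variable (\<open>solvable_univariate\<close>). With these two
  steps a cubic and a quadric are seen to vanish on a 3-dimensional subspace of every space of
  dimension 18. There the quartic and the quintic cut out two plane curves, whose intersection is
  governed by a resultant of degree \<open>4 \<cdot> 5 = 20\<close> (\<open>plane_curves_meet\<close>). The linear form costs one more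
  dimension.

  All of this works in every characteristic: polars are coefficients of expansions, and no
  factorial is ever inverted.
\<close>

section \<open>Products over the roots of a polynomial\<close>

context field_hom
begin

text \<open>
  Only finitely many values are needed to recover a polynomial, so values in the smaller field at
  infinitely many of its points force the coefficients into that field. This replaces the theorem
  on symmetric functions: it suffices to know values. The set of points is a parameter because the
  induction divides by \<open>x - c\<close> and has to give up the point \<open>c\<close>.
\<close>

lemma coeffs_in_range_if_values_in_range:
  fixes P :: "'b poly"
  assumes "infinite A" "\<And>c. c \<in> A \<Longrightarrow> poly P (hom c) \<in> range hom"
  shows "coeff P i \<in> range hom"
  using assms
proof (induction "degree P" arbitrary: P A i)
  case 0
  from \<open>infinite A\<close> obtain c where c: "c \<in> A"
    by (metis equals0I finite.emptyI)
  from 0 obtain a where P: "P = [:a:]" by (metis degree_eq_zeroE)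
  with 0(3)[OF c] have "a \<in> range hom" by simp
  moreover have "0 \<in> range hom" by (metis hom_zero rangeI)
  ultimately show ?case by (simp add: P coeff_pCons split: nat.split)
next
  case (Suc d)
  from \<open>infinite A\<close> obtain c where c: "c \<in> A"
    by (metis equals0I finite.emptyI)
  define Q where "Q = synthetic_div P (hom c)"
  have P: "P = [:- hom c, 1:] * Q + [:poly P (hom c):]"
    unfolding Q_def by (rule synthetic_div_correct'[symmetric])
  have Q: "poly Q (hom x) \<in> range hom" if x: "x \<in> A - {c}" for x
  proof -
    have "hom x - hom c \<noteq> 0" using x by (simp add: hom_minus[symmetric] del: hom_minus)
    moreover have "poly P (hom x) = (hom x - hom c) * poly Q (hom x) + poly P (hom c)"
      by (subst P) (simp add: algebra_simps)
    ultimately have "poly Q (hom x) = (poly P (hom x) - poly P (hom c)) / (hom x - hom c)"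
      by (simp add: field_simps)
    moreover obtain u where "poly P (hom x) = hom u"
      using Suc.prems(2)[of x] x by blast
    moreover obtain v where "poly P (hom c) = hom v"
      using Suc.prems(2)[OF c] by blast
    ultimately have "poly Q (hom x) = hom ((u - v) / (x - c))"
      by (simp add: hom_distribs)
    thus ?thesis by blast
  qed
  have "d = degree Q" using Suc.hyps(2) by (simp add: Q_def degree_synthetic_div)
  have IH: "coeff Q j \<in> range hom" for j
    by (rule Suc.hyps(1)[of Q "A - {c}"]) (use Suc.prems(1) \<open>d = degree Q\<close> Q in simp_all)
  obtain u where u: "poly P (hom c) = hom u" using Suc.prems(2)[OF c] by auto
  have "coeff P i = (if i = 0 then 0 else coeff Q (i - 1)) - hom c * coeff Q i + (if i = 0 then hom u else 0)"
    by (subst P) (auto simp: coeff_pCons u split: nat.split)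
  moreover obtain v where v: "coeff Q i = hom v" using IH by blast
  moreover obtain w where w: "coeff Q (i - 1) = hom w" using IH by blast
  ultimately have "coeff P i = hom ((if i = 0 then 0 else w) - c * v + (if i = 0 then u else 0))"
    by (simp add: hom_distribs)
  thus ?case by blast
qed

end

lemma
  fixes p :: "'a::alg_closed_field poly"
  shows alg_closed_factorization: "p = smult (lead_coeff p) (\<Prod>x\<in>#proots p. [:- x, 1:])"
    and size_proots_alg_closed: "size (proots p) = degree p"
proof -
  have "p = smult (lead_coeff p) (\<Prod>x\<in>#proots p. [:- x, 1:]) \<and> size (proots p) = degree p"
  proof (cases "p = 0")
    case False
    obtain A where A: "size A = degree p" "p = smult (lead_coeff p) (\<Prod>x\<in>#A. [:-x, 1:])"
      using alg_closed_imp_factorization[OF False] by blast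
    have "proots p = proots (\<Prod>x\<in>#A. [:-x, 1:])"
      by (subst A(2), rule proots_smult) (use False in simp)
    also have "\<dots> = A"
    proof (induction A)
      case (add x A)
      have "[:- x, 1:] \<noteq> 0" "(\<Prod>x\<in>#A. [:- x, 1:]) \<noteq> 0"
        by (auto simp: prod_mset_zero_iff)
      thus ?case using add by (simp add: proots_mult del: mult_pCons_left)
    qed simp
    finally show ?thesis using A by simp
  qed simp
  thus "p = smult (lead_coeff p) (\<Prod>x\<in>#proots p. [:- x, 1:])" "size (proots p) = degree p" by blast+
qed

lemma poly_alg_closed_eq:
  fixes p :: "'a::alg_closed_field poly"
  shows "poly p y = lead_coeff p * (\<Prod>x\<in>#proots p. y - x)"
  by (subst alg_closed_factorization) (simp add: poly_prod_mset image_mset.compositionality o_def)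



locale closure_hom = field_hom hom
  for hom :: "'k::field \<Rightarrow> 'c::alg_closed_field"
begin

sublocale hom_poly: map_poly_inj_idom_hom hom ..

text \<open>
  The product is the resultant of \<open>p\<close> and \<open>f\<close> up to a power of the leading coefficient of
  \<open>p\<close>. By the symmetry \<open>\<Prod>\<^sub>x f(x) = \<plusminus> c \<Prod>\<^sub>z p(z)\<close> between the roots \<open>x\<close> of \<open>p\<close> and \<open>z\<close> of \<open>f\<close>,
  where \<open>p(z)\<close> may be replaced by \<open>(p mod f)(z)\<close>, it is computed by Euclid's algorithm
  and therefore never leaves the smaller field.
\<close>

lemma prod_over_roots_in_range:
  fixes p f :: "'k poly"
  assumes "p \<noteq> 0"
  shows "(\<Prod>x\<in>#proots (map_poly hom p). poly (map_poly hom f) x) \<in> range hom"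
  using assms
proof (induction "degree f" arbitrary: p f rule: less_induct)
  case less
  define P where "P = map_poly hom p"
  define F where "F = map_poly hom f"
  show ?case
  proof (cases "degree f = 0")
    case True
    then obtain c where "f = [:c:]" by (metis degree_eq_zeroE)
    hence "(\<Prod>x\<in>#proots P. poly F x) = hom (c ^ size (proots P))"
      by (simp add: F_def hom_distribs)
    thus ?thesis unfolding P_def F_def by (metis rangeI)
  next
    case False
    hence "f \<noteq> 0" by auto
    define a where "a = lead_coeff f"
    define b where "b = lead_coeff p"
    have b: "hom b \<noteq> 0" using less.prems by (simp add: b_def)
    have lc: "lead_coeff P = hom b" "lead_coeff F = hom a"
      by (simp_all add: P_def F_def a_def b_def)
    let ?m = "size (proots P)" and ?n = "size (proots F)"
    have swap: "(\<Prod>x\<in>#proots P. x - z) = (-1) ^ ?m / hom b * poly P z" for z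
    proof -
      have "(\<Prod>x\<in>#proots P. x - z) = (\<Prod>x\<in>#proots P. (-1) * (z - x))" by simp
      also have "\<dots> = (-1) ^ ?m * (\<Prod>x\<in>#proots P. z - x)"
        unfolding prod_mset.distrib by simp
      also have "\<dots> = (-1) ^ ?m / hom b * poly P z"
        using b by (subst poly_alg_closed_eq[of P]) (simp add: lc)
      finally show ?thesis .
    qed
    have "(\<Prod>x\<in>#proots P. poly F x) = (\<Prod>x\<in>#proots P. hom a * (\<Prod>z\<in>#proots F. x - z))"
      by (subst poly_alg_closed_eq[of F]) (simp add: lc)
    also have "\<dots> = hom a ^ ?m * (\<Prod>x\<in>#proots P. \<Prod>z\<in>#proots F. x - z)"
      by (simp add: prod_mset.distrib)
    also have "(\<Prod>x\<in>#proots P. \<Prod>z\<in>#proots F. x - z) = (\<Prod>z\<in>#proots F. \<Prod>x\<in>#proots P. x - z)"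
      by (rule prod_mset.swap)
    also have "\<dots> = ((-1) ^ ?m / hom b) ^ ?n * (\<Prod>z\<in>#proots F. poly P z)"
      unfolding swap prod_mset.distrib by simp
    also have "(\<Prod>z\<in>#proots F. poly P z) = (\<Prod>z\<in>#proots F. poly (map_poly hom (p mod f)) z)"
    proof (rule arg_cong[of _ _ prod_mset], rule image_mset_cong)
      fix z assume "z \<in># proots F"
      hence z: "poly F z = 0" using \<open>f \<noteq> 0\<close> by (auto simp: F_def)
      have "P = map_poly hom (p div f * f + p mod f)" by (simp add: P_def)
      also have "\<dots> = map_poly hom (p div f) * F + map_poly hom (p mod f)"
        by (simp only: F_def hom_poly.hom_add hom_poly.hom_mult)
      finally show "poly P z = poly (map_poly hom (p mod f)) z" using z by simp
    qed
    finally have eq: "(\<Prod>x\<in>#proots P. poly F x) = hom a ^ ?m * (((-1) ^ ?m / hom b) ^ ?n *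
      (\<Prod>z\<in>#proots F. poly (map_poly hom (p mod f)) z))" .
    have "degree (p mod f) < degree f"
      using False \<open>f \<noteq> 0\<close> by (metis degree_0 degree_mod_less not_gr0)
    from less.hyps[OF this \<open>f \<noteq> 0\<close>] obtain c where
      "(\<Prod>z\<in>#proots F. poly (map_poly hom (p mod f)) z) = hom c"
      unfolding F_def by blast
    with eq have "(\<Prod>x\<in>#proots P. poly F x) = hom (a ^ ?m * (((-1) ^ ?m / b) ^ ?n * c))"
      by (simp add: hom_distribs)
    thus ?thesis unfolding P_def F_def by blast
  qed
qed

text \<open>
  Evaluating the transformed polynomial at a constant \<open>c\<close> gives the product of the values
  of \<open>c - T\<close> over the roots of \<open>p\<close>.
\<close>

lemma coeff_prod_roots_in_range:
  fixes p T :: "'k poly"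
  assumes "p \<noteq> 0" "infinite (UNIV :: 'k set)"
  shows "coeff (\<Prod>x\<in>#proots (map_poly hom p). [:- poly (map_poly hom T) x, 1:]) i \<in> range hom"
proof (rule coeffs_in_range_if_values_in_range[OF assms(2)])
  fix c :: 'k
  have "poly (\<Prod>x\<in>#proots (map_poly hom p). [:- poly (map_poly hom T) x, 1:]) (hom c) =
    (\<Prod>x\<in>#proots (map_poly hom p). poly (map_poly hom ([:c:] - T)) x)"
    by (simp add: poly_prod_mset image_mset.compositionality o_def hom_poly.hom_minus
        map_poly_pCons_hom)
  also have "\<dots> \<in> range hom" by (rule prod_over_roots_in_range[OF assms(1)])
  finally show "poly (\<Prod>x\<in>#proots (map_poly hom p). [:- poly (map_poly hom T) x, 1:]) (hom c)
    \<in> range hom" .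
qed

end

section \<open>Intersection of plane curves\<close>

locale root_closed =
  fixes D :: nat and k :: "'k::field itself"
  assumes two_le: "2 \<le> D"
    and ex_root: "\<And>f :: 'k poly. 0 < degree f \<Longrightarrow> degree f \<le> D \<Longrightarrow> \<exists>x. poly f x = 0"
begin

text \<open>
  On a finite field \<open>x \<mapsto> x\<^sup>2 - x\<close> is not injective, hence not surjective, so some quadratic polynomial
  has no root.
\<close>

lemma infinite_field: "infinite (UNIV :: 'k set)"
proof
  assume "finite (UNIV :: 'k set)"
  moreover have "\<not> inj (\<lambda>x::'k. x * x - x)"
  proof
    assume "inj (\<lambda>x::'k. x * x - x)"
    from injD[OF this, of 0 1] show False by simp
  qed
  ultimately have "\<not> surj (\<lambda>x::'k. x * x - x)"
    using finite_UNIV_surj_inj by blast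
  then obtain c :: 'k where c: "\<And>x. x * x - x \<noteq> c" unfolding surj_def by metis
  have "\<exists>x. poly [:- c, - 1, 1:] x = 0"
    by (rule ex_root) (use two_le in simp_all)
  then obtain x where "poly [:- c, - 1, 1:] x = 0" ..
  hence "x * x - x = c" by (simp add: algebra_simps)
  with c show False by blast
qed

end

lemma coeff_mult_degree_le:
  fixes p q :: "'a::comm_semiring_0 poly"
  assumes "degree p \<le> m" "degree q \<le> n"
  shows "coeff (p * q) (m + n) = coeff p m * coeff q n"
proof (cases "degree p = m \<and> degree q = n")
  case True
  thus ?thesis using coeff_mult_degree_sum[of p q] by simp
next
  case False
  hence "degree p + degree q < m + n" "degree p < m \<or> degree q < n" using assms by auto
  moreover have "degree (p * q) \<le> degree p + degree q" by (rule degree_mult_le)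
  ultimately show ?thesis by (auto simp: coeff_eq_0)
qed

lemma
  fixes f :: "'b \<Rightarrow> 'a::comm_semiring_1 poly"
  assumes "finite A" "\<And>i. i \<in> A \<Longrightarrow> degree (f i) \<le> e i"
  shows degree_prod_le_sum: "degree (prod f A) \<le> sum e A"
    and coeff_prod_sum: "coeff (prod f A) (sum e A) = (\<Prod>i\<in>A. coeff (f i) (e i))"
proof -
  have "degree (prod f A) \<le> sum e A \<and> coeff (prod f A) (sum e A) = (\<Prod>i\<in>A. coeff (f i) (e i))"
    using assms
  proof (induction A rule: finite_induct)
    case (insert a A)
    hence "degree (f a) \<le> e a" "degree (prod f A) \<le> sum e A" by auto
    thus ?case using insert
      by (auto simp: coeff_mult_degree_le intro: order.trans[OF degree_mult_le add_mono])
  qed simp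
  thus "degree (prod f A) \<le> sum e A" "coeff (prod f A) (sum e A) = (\<Prod>i\<in>A. coeff (f i) (e i))"
    by auto
qed

text \<open>
  If the entry in row \<open>i\<close> and column \<open>j\<close> has degree at most \<open>b\<^sub>j - i\<close>, then every term of the Leibniz
  expansion has degree at most \<open>\<Sum> b - \<Sum> i\<close>, whatever the permutation. An entry with \<open>b\<^sub>j < i\<close> is zero by
  hypothesis, so the truncated exponent \<open>b\<^sub>j - i\<close> in the second claim is harmless.
\<close>

lemma
  fixes M :: "'a::comm_ring_1 poly mat"
  assumes M: "M \<in> carrier_mat N N"
    and deg: "\<And>i j. i < N \<Longrightarrow> j < N \<Longrightarrow> M $$ (i, j) \<noteq> 0 \<Longrightarrow> degree (M $$ (i, j)) + i \<le> b j"
    and sum: "(\<Sum>j<N. b j) = (\<Sum>i<N. i) + d"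
  shows degree_det_graded: "degree (det M) \<le> d"
    and coeff_det_graded: "coeff (det M) d = det (mat N N (\<lambda>(i, j). coeff (M $$ (i, j)) (b j - i)))"
proof -
  have *: "degree (\<Prod>i = 0..<N. M $$ (i, p i)) \<le> d \<and>
    coeff (\<Prod>i = 0..<N. M $$ (i, p i)) d = (\<Prod>i = 0..<N. coeff (M $$ (i, p i)) (b (p i) - i))"
    if p: "p permutes {0..<N}" for p
  proof (cases "\<exists>i<N. M $$ (i, p i) = 0")
    case True
    then obtain i where i: "i < N" "M $$ (i, p i) = 0" by blast
    have "(\<Prod>i = 0..<N. M $$ (i, p i)) = 0"
      by (rule prod_zero) (use i in auto)
    moreover have "(\<Prod>i = 0..<N. coeff (M $$ (i, p i)) (b (p i) - i)) = 0"
      by (rule prod_zero) (use i in \<open>auto intro!: bexI[of _ i]\<close>)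
    ultimately show ?thesis by simp
  next
    case False
    have le: "degree (M $$ (i, p i)) + i \<le> b (p i)" if "i < N" for i
      using deg[of i "p i"] False that permutes_in_image[OF p, of i] by auto
    have "(\<Sum>i = 0..<N. b (p i) - i) + (\<Sum>i = 0..<N. i) = (\<Sum>i = 0..<N. b (p i))"
      unfolding sum.distrib[symmetric] by (rule sum.cong) (use le in force)+
    also have "\<dots> = (\<Sum>i = 0..<N. b i)"
      using sum.permute[OF p, of b] by (simp add: o_def)
    finally have d: "(\<Sum>i = 0..<N. b (p i) - i) = d"
      using sum by (simp add: lessThan_atLeast0)
    have le': "degree (M $$ (i, p i)) \<le> b (p i) - i" if "i \<in> {0..<N}" for i
      using le[of i] that by auto
    show ?thesis
      using degree_prod_le_sum[of "{0..<N}" "\<lambda>i. M $$ (i, p i)" "\<lambda>i. b (p i) - i"]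
        coeff_prod_sum[of "{0..<N}" "\<lambda>i. M $$ (i, p i)" "\<lambda>i. b (p i) - i"] le'
      unfolding d by auto
  qed
  show "degree (det M) \<le> d"
    unfolding det_def'[OF M]
    by (rule degree_sum_le) (use * in \<open>auto simp: sign_def finite_permutations\<close>)
  have "coeff (det M) d = (\<Sum>p | p permutes {0..<N}. signof p *
      (\<Prod>i = 0..<N. coeff (M $$ (i, p i)) (b (p i) - i)))"
    unfolding det_def'[OF M] coeff_sum
    by (rule sum.cong) (use * in \<open>auto simp: sign_def\<close>)
  also have "\<dots> = det (mat N N (\<lambda>(i, j). coeff (M $$ (i, j)) (b j - i)))"
    by (subst det_def'[of _ N], simp, rule sum.cong, simp)
       (auto intro!: prod.cong arg_cong[of _ _ "(*) _"] dest: permutes_in_image)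
  finally show "coeff (det M) d = det (mat N N (\<lambda>(i, j). coeff (M $$ (i, j)) (b j - i)))" .
qed

text \<open>
  When this common divisor is constant, the combination expresses coprimality as an equation, which can
  be multiplied by the members of a relation \<open>U P + W Q = 0\<close> to show that \<open>P\<close> divides \<open>W\<close>.
\<close>

lemma poly_bezout:
  fixes P Q :: "'a::field poly"
  assumes "P \<noteq> 0 \<or> Q \<noteq> 0"
  shows "\<exists>a b. a * P + b * Q \<noteq> 0 \<and> a * P + b * Q dvd P \<and> a * P + b * Q dvd Q"
  using assms
proof (induction "degree Q" arbitrary: P Q rule: less_induct)
  case less
  show ?case
  proof (cases "Q = 0")
    case True
    thus ?thesis using less.prems by (intro exI[of _ 1] exI[of _ 0]) auto
  next
    case False
    have "\<exists>a b. a * Q + b * (P mod Q) \<noteq> 0 \<and> a * Q + b * (P mod Q) dvd Q \<and>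
      a * Q + b * (P mod Q) dvd P mod Q"
    proof (cases "P mod Q = 0")
      case True
      thus ?thesis using False by (intro exI[of _ 1] exI[of _ 0]) auto
    next
      case 2: False
      show ?thesis
        by (rule less.hyps) (use False 2 in \<open>auto simp: degree_mod_less'\<close>)
    qed
    then obtain a b where ab: "a * Q + b * (P mod Q) \<noteq> 0" "a * Q + b * (P mod Q) dvd Q"
      "a * Q + b * (P mod Q) dvd P mod Q" by blast
    have eq: "a * Q + b * (P mod Q) = b * P + (a - b * (P div Q)) * Q"
      by (simp add: minus_div_mult_eq_mod[symmetric] algebra_simps)
    have "a * Q + b * (P mod Q) dvd P"
      using dvd_add[OF dvd_mult[OF ab(2), of "P div Q"] ab(3)] by simp
    with ab show ?thesis unfolding eq by blast
  qed
qed

text \<open>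
  The transposed Sylvester matrix, with the two degrees as parameters: a specialisation of \<open>P\<close> or \<open>Q\<close>
  may have a smaller degree than \<open>m\<close> or \<open>n\<close>, but the matrix must commute with specialisation.
\<close>

definition sylvester :: "nat \<Rightarrow> nat \<Rightarrow> 'a::comm_ring_1 poly \<Rightarrow> 'a poly \<Rightarrow> 'a mat" where
  "sylvester m n P Q = mat (m + n) (m + n) (\<lambda>(i, j).
     if j < n then coeff (monom 1 j * P) i else coeff (monom 1 (j - n) * Q) i)"

lemma sylvester_carrier [simp]: "sylvester m n P Q \<in> carrier_mat (m + n) (m + n)"
  by (simp add: sylvester_def)

lemma sylvester_kernel:
  fixes P Q :: "'a::comm_ring_1 poly" and v :: "'a vec"
  assumes "degree P \<le> m" "degree Q \<le> n" "v \<in> carrier_vec (m + n)"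
    and "sylvester m n P Q *\<^sub>v v = 0\<^sub>v (m + n)"
  shows "(\<Sum>j<n. monom (v $ j) j) * P + (\<Sum>j<m. monom (v $ (n + j)) j) * Q = 0"
proof (rule poly_eqI)
  fix i
  have split: "(\<Sum>j<n + m. f j) = (\<Sum>j<n. f j) + (\<Sum>j<m. f (n + j))" for f :: "nat \<Rightarrow> 'a" and m
    by (induction m) (simp_all add: add.assoc)
  have "coeff ((\<Sum>j<n. monom (v $ j) j) * P + (\<Sum>j<m. monom (v $ (n + j)) j) * Q) i =
    (\<Sum>j<n. v $ j * coeff (monom 1 j * P) i) + (\<Sum>j<m. v $ (n + j) * coeff (monom 1 j * Q) i)"
    by (simp add: sum_distrib_right coeff_sum coeff_monom_mult if_distrib cong: if_cong)
  also have "\<dots> = 0"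
  proof (cases "i < m + n")
    case True
    have "(\<Sum>j<m + n. v $ j * sylvester m n P Q $$ (i, j)) = (sylvester m n P Q *\<^sub>v v) $ i"
      using True assms(3) by (simp add: sylvester_def scalar_prod_def lessThan_atLeast0 mult_ac)
    also have "\<dots> = 0" using True by (simp add: assms(4))
    finally have "(\<Sum>j<n + m. v $ j * sylvester m n P Q $$ (i, j)) = 0" by (simp add: add.commute)
    hence "(\<Sum>j<n. v $ j * sylvester m n P Q $$ (i, j)) +
      (\<Sum>j<m. v $ (n + j) * sylvester m n P Q $$ (i, n + j)) = 0"
      by (simp only: split)
    thus ?thesis using True by (simp add: sylvester_def)
  next
    case False
    hence "(\<Sum>j<n. v $ j * coeff (monom 1 j * P) i) = 0"
      "(\<Sum>j<m. v $ (n + j) * coeff (monom 1 j * Q) i) = 0"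
      using assms(1,2) by (auto simp: coeff_monom_mult coeff_eq_0 intro!: sum.neutral)
    thus ?thesis by simp
  qed
  finally show "coeff ((\<Sum>j<n. monom (v $ j) j) * P + (\<Sum>j<m. monom (v $ (n + j)) j) * Q) i
    = coeff 0 i" by simp
qed

context root_closed
begin

text \<open>
  A kernel vector is a relation \<open>U P + W Q = 0\<close> with \<open>deg U < n\<close> and \<open>deg W < m\<close>. If \<open>P\<close> and \<open>Q\<close>
  were coprime, then \<open>P\<close> would divide \<open>W\<close> and \<open>Q\<close> would divide \<open>U\<close>. It is enough that one of the two
  polynomials has its full degree: this makes \<open>W\<close> or \<open>U\<close> vanish, and then the other one as well.
\<close>

lemma common_root_if_det_sylvester_0:
  fixes P Q :: "'k poly"
  assumes deg: "degree P \<le> m" "degree Q \<le> n" "m \<le> D" "n \<le> D"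
    and lead: "coeff P m \<noteq> 0 \<or> coeff Q n \<noteq> 0"
    and det: "det (sylvester m n P Q) = 0"
  shows "\<exists>z. poly P z = 0 \<and> poly Q z = 0"
proof -
  obtain v :: "'k vec" where v: "v \<in> carrier_vec (m + n)" "v \<noteq> 0\<^sub>v (m + n)"
    "sylvester m n P Q *\<^sub>v v = 0\<^sub>v (m + n)"
    using det det_0_iff_vec_prod_zero_field[OF sylvester_carrier] by blast
  define U where "U = (\<Sum>j<n. monom (v $ j) j)"
  define W where "W = (\<Sum>j<m. monom (v $ (n + j)) j)"
  have UW: "U * P + W * Q = 0"
    unfolding U_def W_def by (rule sylvester_kernel) (use deg v in auto)
  have coeff_U: "coeff U j = (if j < n then v $ j else 0)" for j
    by (simp add: U_def coeff_sum)
  have coeff_W: "coeff W j = (if j < m then v $ (n + j) else 0)" for j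
    by (simp add: W_def coeff_sum)
  have nz: "\<not> (U = 0 \<and> W = 0)"
  proof
    assume 0: "U = 0 \<and> W = 0"
    have "v $ j = 0" if "j < m + n" for j
    proof (cases "j < n")
      case True
      thus ?thesis using coeff_U[of j] 0 by simp
    next
      case False
      thus ?thesis using coeff_W[of "j - n"] 0 that by (simp split: if_splits)
    qed
    with v(1,2) show False by (auto intro!: eq_vecI)
  qed
  have "P \<noteq> 0 \<or> Q \<noteq> 0" using lead by auto
  then obtain a b where ab: "a * P + b * Q \<noteq> 0" "a * P + b * Q dvd P" "a * P + b * Q dvd Q"
    using poly_bezout by blast
  define T where "T = a * P + b * Q"
  have "degree T \<le> D"
    using \<open>P \<noteq> 0 \<or> Q \<noteq> 0\<close> dvd_imp_degree_le[of T P] dvd_imp_degree_le[of T Q] ab deg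
    unfolding T_def by linarith
  have "0 < degree T"
  proof (rule ccontr)
    assume "\<not> 0 < degree T"
    then obtain t where t: "T = [:t:]" by (metis degree_eq_zeroE gr0I)
    with ab(1) have "t \<noteq> 0" by (auto simp: T_def)
    have "smult t W = P * (a * W - b * U)"
    proof -
      have "smult t W = W * (a * P + b * Q)" using t by (simp add: T_def)
      also have "\<dots> = P * (a * W - b * U) + b * (U * P + W * Q)" by (simp add: algebra_simps)
      finally show ?thesis by (simp add: UW)
    qed
    hence "P dvd W" using \<open>t \<noteq> 0\<close> by (metis dvd_smult_cancel dvd_triv_left)
    have "smult t U = Q * (b * U - a * W)"
    proof -
      have "smult t U = U * (a * P + b * Q)" using t by (simp add: T_def)
      also have "\<dots> = Q * (b * U - a * W) + a * (U * P + W * Q)" by (simp add: algebra_simps)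
      finally show ?thesis by (simp add: UW)
    qed
    hence "Q dvd U" using \<open>t \<noteq> 0\<close> by (metis dvd_smult_cancel dvd_triv_left)
    from lead show False
    proof
      assume P: "coeff P m \<noteq> 0"
      have "W = 0"
      proof (rule ccontr)
        assume "W \<noteq> 0"
        hence "coeff W (degree W) \<noteq> 0" by simp
        hence "degree W < m" unfolding coeff_W by (simp split: if_splits)
        moreover have "m \<le> degree P" using P by (rule le_degree)
        ultimately show False using dvd_imp_degree_le[OF \<open>P dvd W\<close> \<open>W \<noteq> 0\<close>] by simp
      qed
      with UW P nz show False by auto
    next
      assume Q: "coeff Q n \<noteq> 0"
      have "U = 0"
      proof (rule ccontr)
        assume "U \<noteq> 0"
        hence "coeff U (degree U) \<noteq> 0" by simp
        hence "degree U < n" unfolding coeff_U by (simp split: if_splits)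
        moreover have "n \<le> degree Q" using Q by (rule le_degree)
        ultimately show False using dvd_imp_degree_le[OF \<open>Q dvd U\<close> \<open>U \<noteq> 0\<close>] by simp
      qed
      with UW Q nz show False by auto
    qed
  qed
  from ex_root[OF this \<open>degree T \<le> D\<close>] obtain z where "poly T z = 0" ..
  thus ?thesis using ab(2,3) unfolding T_def[symmetric] by (auto elim!: dvdE)
qed

text \<open>
  Bezout's theorem for two plane curves of degrees \<open>m\<close> and \<open>n\<close>, in affine coordinates \<open>x\<close> and \<open>z\<close>. The
  determinant of the Sylvester matrix with respect to \<open>z\<close> is a polynomial in \<open>x\<close> of degree at most
  \<open>m n\<close>, and its coefficient at \<open>m n\<close> is the same determinant on the line at infinity. So
  either it has a root, or it is a nonzero constant and the curves meet at infinity, which is the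
  second alternative. The last hypothesis says that the curves do not both pass through the centre of
  the projection along \<open>z\<close>.
\<close>

lemma plane_curves_meet:
  fixes P Q :: "'k poly poly"
  assumes P: "\<And>i. coeff P i \<noteq> 0 \<Longrightarrow> degree (coeff P i) + i \<le> m"
    and Q: "\<And>i. coeff Q i \<noteq> 0 \<Longrightarrow> degree (coeff Q i) + i \<le> n"
    and mn: "1 \<le> m" "1 \<le> n" "m * n \<le> D"
    and lead: "coeff P m \<noteq> 0 \<or> coeff Q n \<noteq> 0"
  shows "(\<exists>x z. poly (poly P [:z:]) x = 0 \<and> poly (poly Q [:z:]) x = 0) \<or>
    (\<exists>z. (\<Sum>i\<le>m. coeff (coeff P i) (m - i) * z ^ i) = 0 \<and>
         (\<Sum>i\<le>n. coeff (coeff Q i) (n - i) * z ^ i) = 0)"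
proof -
  have le: "m \<le> D" "n \<le> D" using mn
    by (metis One_nat_def Suc_le_eq dual_order.trans le_add1 mult.commute mult_le_mono2 nat_mult_1_right)+
  have degs: "degree P \<le> m" "degree Q \<le> n"
    using P Q by (auto intro!: degree_le) (metis add_leD2 not_less)+
  define A where "A = sylvester m n P Q"
  have A: "A \<in> carrier_mat (m + n) (m + n)" by (simp add: A_def)
  \<comment> \<open>column \<open>j\<close> holds \<open>z^j P\<close> of total degree \<open>m + j\<close>, or \<open>z^(j - n) Q\<close> of total degree \<open>n + (j - n)\<close>\<close>
  define b where "b j = (if j < n then m + j else j)" for j
  have deg: "degree (A $$ (i, j)) + i \<le> b j" if "i < m + n" "j < m + n" "A $$ (i, j) \<noteq> 0" for i j
    using that P[of "i - j"] Q[of "i - (j - n)"]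
    by (auto simp: A_def sylvester_def b_def coeff_monom_mult split: if_splits)
  have sum: "(\<Sum>j<m + n. b j) = (\<Sum>i<m + n. i) + m * n"
  proof -
    have "(\<Sum>j<m + n. b j) = (\<Sum>j<m + n. j + (if j < n then m else 0))"
      by (rule sum.cong) (auto simp: b_def)
    also have "\<dots> = (\<Sum>i<m + n. i) + (\<Sum>j<m + n. if j < n then m else 0)"
      by (rule sum.distrib)
    also have "(\<Sum>j<m + n. if j < n then m else 0) = (\<Sum>j\<in>{..<n}. m)"
      by (rule sum.mono_neutral_cong_right) auto
    finally show ?thesis by (simp add: mult.commute)
  qed
  show ?thesis
  proof (cases "\<exists>x. poly (det A) x = 0")
    case True
    then obtain x where x: "poly (det A) x = 0" ..
    let ?ev = "map_poly (\<lambda>c. poly c x)"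
    have "map_mat (\<lambda>c. poly c x) A = sylvester m n (?ev P) (?ev Q)"
      by (rule eq_matI) (auto simp: A_def sylvester_def coeff_monom_mult)
    hence "det (sylvester m n (?ev P) (?ev Q)) = 0"
      using comm_ring_hom.hom_det[OF poly_hom.comm_ring_hom_axioms, of x A] x by simp
    moreover have "degree (?ev P) \<le> m" "degree (?ev Q) \<le> n"
      using degs by (auto intro: order.trans[OF degree_map_poly_le])
    moreover have "coeff (?ev P) m \<noteq> 0 \<or> coeff (?ev Q) n \<noteq> 0"
      using lead
    proof
      assume *: "coeff P m \<noteq> 0"
      with P[OF *] obtain c where "coeff P m = [:c:]" by (metis add_le_same_cancel2 degree_eq_zeroE le_zero_eq)
      thus ?thesis using * by simp
    next
      assume *: "coeff Q n \<noteq> 0"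
      with Q[OF *] obtain c where "coeff Q n = [:c:]" by (metis add_le_same_cancel2 degree_eq_zeroE le_zero_eq)
      thus ?thesis using * by simp
    qed
    ultimately obtain z where "poly (?ev P) z = 0" "poly (?ev Q) z = 0"
      using common_root_if_det_sylvester_0 le by blast
    moreover have "poly (?ev p) z = poly (poly p [:z:]) x" for p
      using poly_hom.poly_map_poly[of x p "[:z:]"] by simp
    ultimately show ?thesis by metis
  next
    case False
    have "degree (det A) \<le> D"
      using degree_det_graded[OF A deg sum] mn by linarith
    with False ex_root[of "det A"] have "degree (det A) = 0" by blast
    hence 0: "coeff (det A) (m * n) = 0" using mn by (intro coeff_eq_0) auto
    define top where "top d p = (\<Sum>i\<le>d. monom (coeff (coeff p i) (d - i)) i)" for d and p :: "'k poly poly"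
    have coeff_top: "coeff (top d p) i = (if i \<le> d then coeff (coeff p i) (d - i) else 0)" for d p i
      by (simp add: top_def coeff_sum)
    have "mat (m + n) (m + n) (\<lambda>(i, j). coeff (A $$ (i, j)) (b j - i)) = sylvester m n (top m P) (top n Q)"
    proof (rule eq_matI)
      fix i j assume "i < dim_row (sylvester m n (top m P) (top n Q))"
        "j < dim_col (sylvester m n (top m P) (top n Q))"
      hence ij: "i < m + n" "j < m + n" by (simp_all add: sylvester_def)
      have "coeff P (i - j) = 0" if "m < i - j"
        using P[of "i - j"] that by (metis add_leD2 not_less)
      moreover have "coeff Q (i - (j - n)) = 0" if "n < i - (j - n)"
        using Q[of "i - (j - n)"] that by (metis add_leD2 not_less)
      moreover have "m + j - i = m - (i - j)" if "j \<le> i" using that by simp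
      moreover have "j - i = n - (i - (j - n))" if "n \<le> j" "j - n \<le> i" using that by simp
      ultimately show "mat (m + n) (m + n) (\<lambda>(i, j). coeff (A $$ (i, j)) (b j - i)) $$ (i, j) =
        sylvester m n (top m P) (top n Q) $$ (i, j)"
        using ij
        by (cases "j < n"; cases "j \<le> i"; cases "j - n \<le> i")
           (simp_all add: A_def sylvester_def b_def coeff_monom_mult coeff_top not_le not_less
             split: if_splits del: diff_diff_right Nat.diff_diff_right Nat.add_diff_assoc2)
    qed (simp_all add: sylvester_def)
    hence "det (sylvester m n (top m P) (top n Q)) = 0"
      using coeff_det_graded[OF A deg sum] 0 by simp
    moreover have "degree (top m P) \<le> m" "degree (top n Q) \<le> n"
      by (auto intro!: degree_le simp: coeff_top)
    moreover have "coeff (top m P) m \<noteq> 0 \<or> coeff (top n Q) n \<noteq> 0"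
      using lead
    proof
      assume *: "coeff P m \<noteq> 0"
      with P[OF *] obtain c where "coeff P m = [:c:]" by (metis add_le_same_cancel2 degree_eq_zeroE le_zero_eq)
      thus ?thesis using * by (simp add: coeff_top)
    next
      assume *: "coeff Q n \<noteq> 0"
      with Q[OF *] obtain c where "coeff Q n = [:c:]" by (metis add_le_same_cancel2 degree_eq_zeroE le_zero_eq)
      thus ?thesis using * by (simp add: coeff_top)
    qed
    ultimately obtain z where "poly (top m P) z = 0" "poly (top n Q) z = 0"
      using common_root_if_det_sylvester_0 le by blast
    thus ?thesis by (auto simp: top_def poly_sum poly_monom)
  qed
qed

end

section \<open>Forms and their polars\<close>

text \<open>
  The space \<open>'v\<close> is over the small field, while forms take values in the large field: the functions
  \<open>T \<mapsto> T(x\<^sub>i)\<close> are only defined over the latter.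
\<close>

locale form_space = root_closed D k + vector_space scale + field_hom hom
  for D and k :: "'k::field itself"
    and scale :: "'k \<Rightarrow> 'v::ab_group_add \<Rightarrow> 'v" (infixr \<open>*s\<close> 75)
    and hom :: "'k \<Rightarrow> 'c::field"
begin

text \<open>
  Homogeneous polynomial functions of degree \<open>d\<close> are the sums of \<open>d\<close>-fold products of linear
  functionals. Since no coordinates are chosen, a form restricts to a subspace without a change of basis.
\<close>

inductive form :: "nat \<Rightarrow> ('v \<Rightarrow> 'c) \<Rightarrow> bool" where
  const: "form 0 (\<lambda>_. c)"
| mult: "\<lbrakk>\<And>v w. l (v + w) = l v + l w; \<And>a v. l (a *s v) = hom a * l v; form d g\<rbrakk>
    \<Longrightarrow> form (Suc d) (\<lambda>v. l v * g v)"
| add: "form d g \<Longrightarrow> form d h \<Longrightarrow> form d (\<lambda>v. g v + h v)"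

lemma form_zero: "form d (\<lambda>_. 0)"
proof (induction d)
  case 0
  show ?case by (rule form.const)
next
  case (Suc d)
  from form.mult[of "\<lambda>_. 0", OF _ _ Suc] show ?case by simp
qed

lemma form_scale: "form d g \<Longrightarrow> g (a *s v) = hom a ^ d * g v"
  by (induction arbitrary: v rule: form.induct) (simp_all add: algebra_simps)

lemma form_1_additive: "form d g \<Longrightarrow> d = 1 \<Longrightarrow> g (v + w) = g v + g w"
proof (induction rule: form.induct)
  case (mult l d g)
  have "g v = g 0" for v using form_scale[OF mult.hyps(3), of 0 v] mult.prems by simp
  hence "g (v + w) = g 0" "g v = g 0" "g w = g 0" by blast+
  thus ?case by (simp add: mult.hyps(1) algebra_simps)
qed simp_all

text \<open>
  The polars of \<open>g\<close> at \<open>u\<close> are defined as coefficients of an expansion, not by differentiation, so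
  that they make sense in every characteristic.
\<close>

lemma form_polar:
  assumes "form d g"
  shows "\<exists>h. (\<forall>i. form i (h i)) \<and> h 0 = (\<lambda>_. g u) \<and> (\<forall>i>d. h i = (\<lambda>_. 0)) \<and>
    (\<forall>s w. g (s *s u + w) = (\<Sum>i\<le>d. hom s ^ (d - i) * h i w))"
  using assms
proof (induction rule: form.induct)
  case (const c)
  show ?case
    by (rule exI[of _ "\<lambda>i _. if i = 0 then c else 0"]) (auto intro: form.const form_zero)
next
  case (mult l d g)
  from mult.IH obtain h where h: "\<And>i. form i (h i)" "h 0 = (\<lambda>_. g u)" "\<And>i. i > d \<Longrightarrow> h i = (\<lambda>_. 0)"
    "\<And>s w. g (s *s u + w) = (\<Sum>i\<le>d. hom s ^ (d - i) * h i w)" by blast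
  define h' where "h' i = (\<lambda>w. (if i = 0 then 0 else l w * h (i - 1) w) + l u * h i w)" for i
  have "form i (h' i)" for i
  proof (cases i)
    case 0
    thus ?thesis by (simp add: h'_def h(2) form.const)
  next
    case (Suc j)
    have "form (Suc j) (\<lambda>w. l w * h j w)" by (intro form.mult mult.hyps h)
    moreover have "form i (\<lambda>w. l u * h i w)" for i
    proof -
      have "form i g' \<Longrightarrow> form i (\<lambda>w. c * g' w)" for c g'
      proof (induction rule: form.induct)
        case (const c')
        show ?case by (rule form.const)
      next
        case (mult l d g)
        from form.mult[OF mult(1,2) mult(4)] show ?case by (simp add: mult_ac)
      next
        case (add d g h)
        from form.add[OF add(3,4)] show ?case by (simp add: distrib_left)
      qed
      thus ?thesis using h(1) .
    qed
    ultimately show ?thesis unfolding h'_def Suc by (auto intro: form.add)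
  qed
  moreover have "h' 0 = (\<lambda>_. l u * g u)" by (simp add: h'_def h(2))
  moreover have "h' i = (\<lambda>_. 0)" if "i > Suc d" for i
    using that h(3)[of i] h(3)[of "i - 1"] by (auto simp: h'_def)
  moreover have "l (s *s u + w) * g (s *s u + w) = (\<Sum>i\<le>Suc d. hom s ^ (Suc d - i) * h' i w)" for s w
  proof -
    have "(\<Sum>i\<le>Suc d. hom s ^ (Suc d - i) * h' i w)
        = (\<Sum>i\<le>Suc d. hom s ^ (Suc d - i) * (if i = 0 then 0 else l w * h (i - 1) w))
          + (\<Sum>i\<le>Suc d. hom s ^ (Suc d - i) * (l u * h i w))"
      by (simp only: h'_def distrib_left sum.distrib)
    also have "(\<Sum>i\<le>Suc d. hom s ^ (Suc d - i) * (if i = 0 then 0 else l w * h (i - 1) w))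
        = l w * g (s *s u + w)"
      by (simp only: sum.atMost_Suc_shift h(4)) (simp add: sum_distrib_left mult_ac)
    also have "(\<Sum>i\<le>Suc d. hom s ^ (Suc d - i) * (l u * h i w))
        = (\<Sum>i\<le>d. hom s ^ (Suc d - i) * (l u * h i w))"
      by (simp add: h(3))
    also have "\<dots> = hom s * l u * g (s *s u + w)"
      by (simp only: h(4) sum_distrib_left, rule sum.cong) (simp_all add: Suc_diff_le mult_ac)
    finally show ?thesis by (simp add: mult.hyps algebra_simps)
  qed
  ultimately show ?case by (intro exI[of _ h'] conjI allI impI)
next
  case (add d g1 g2)
  then obtain h1 where h1: "\<And>i. form i (h1 i)" "h1 0 = (\<lambda>_. g1 u)" "\<And>i. i > d \<Longrightarrow> h1 i = (\<lambda>_. 0)"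
    "\<And>s w. g1 (s *s u + w) = (\<Sum>i\<le>d. hom s ^ (d - i) * h1 i w)" by blast
  from add obtain h2 where h2: "\<And>i. form i (h2 i)" "h2 0 = (\<lambda>_. g2 u)" "\<And>i. i > d \<Longrightarrow> h2 i = (\<lambda>_. 0)"
    "\<And>s w. g2 (s *s u + w) = (\<Sum>i\<le>d. hom s ^ (d - i) * h2 i w)" by blast
  show ?case
    by (intro exI[of _ "\<lambda>i w. h1 i w + h2 i w"] conjI allI impI)
       (simp_all add: h1 h2 distrib_left sum.distrib form.add)
qed

text \<open>
  The forms that matter are those with values in the small field, although they need not be built from
  functionals with values there.
\<close>

definition kform :: "nat \<Rightarrow> ('v \<Rightarrow> 'k) \<Rightarrow> bool" where
  "kform d g \<longleftrightarrow> form d (\<lambda>v. hom (g v))"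

lemma kform_scale: "kform d g \<Longrightarrow> g (a *s v) = a ^ d * g v"
  using form_scale[of d "\<lambda>v. hom (g v)" a v] by (simp add: kform_def flip: hom_power hom_mult)

lemma kform_1_additive: "kform 1 g \<Longrightarrow> g (v + w) = g v + g w"
  using form_1_additive[of 1 "\<lambda>v. hom (g v)" v w] by (simp add: kform_def flip: hom_add)

definition polars :: "nat \<Rightarrow> ('v \<Rightarrow> 'k) \<Rightarrow> 'v \<Rightarrow> (nat \<Rightarrow> 'v \<Rightarrow> 'k) \<Rightarrow> bool" where
  "polars d g u h \<longleftrightarrow> (\<forall>i. kform i (h i)) \<and> h 0 = (\<lambda>_. g u) \<and>
     (\<forall>s w. g (s *s u + w) = (\<Sum>i\<le>d. s ^ (d - i) * h i w))"

lemma polarsD: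
  assumes "polars d g u h"
  shows "kform i (h i)" "h 0 = (\<lambda>_. g u)" "g (s *s u + w) = (\<Sum>i\<le>d. s ^ (d - i) * h i w)"
  using assms unfolding polars_def by blast+

text \<open>
  For fixed \<open>w\<close> the polars are the coefficients of the polynomial \<open>s \<mapsto> g(su + w)\<close>, whose values
  at \<open>s\<close> in the small field are in that field; so the polars take values in it as well.
\<close>

lemma polars_exist:
  assumes "kform d g"
  shows "\<exists>h. polars d g u h"
proof -
  obtain h where h: "\<And>i. form i (h i)" "h 0 = (\<lambda>_. hom (g u))" "\<And>i. i > d \<Longrightarrow> h i = (\<lambda>_. 0)"
    "\<And>s w. hom (g (s *s u + w)) = (\<Sum>i\<le>d. hom s ^ (d - i) * h i w)"
    using form_polar[OF assms[unfolded kform_def], of u] by blast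
  have rat: "h i w \<in> range hom" for i w
  proof (cases "i \<le> d")
    case True
    define P where "P = (\<Sum>i\<le>d. monom (h i w) (d - i))"
    have "coeff P (d - i) \<in> range hom"
    proof (rule coeffs_in_range_if_values_in_range[OF infinite_field])
      fix s
      have "poly P (hom s) = hom (g (s *s u + w))"
        by (simp add: P_def h(4) poly_sum poly_monom mult_ac)
      thus "poly P (hom s) \<in> range hom" by blast
    qed
    also have "coeff P (d - i) = (\<Sum>j\<le>d. if j = i then h j w else 0)"
      unfolding P_def coeff_sum by (rule sum.cong) (use True in auto)
    also have "\<dots> = h i w" using True by simp
    finally show ?thesis .
  next
    case False
    hence "h i w = hom 0" using h(3) by simp
    thus ?thesis by blast
  qed
  define h' where "h' i w = the_inv hom (h i w)" for i w
  have h': "hom (h' i w) = h i w" for i w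
    unfolding h'_def by (rule f_the_inv_into_f) (use rat in \<open>auto simp: inj_def\<close>)
  have "polars d g u h'"
    unfolding polars_def
  proof (intro conjI allI)
    show "kform i (h' i)" for i by (simp add: kform_def h' h)
    show "h' 0 = (\<lambda>_. g u)"
    proof
      fix w
      have "hom (h' 0 w) = hom (g u)" by (simp add: h' h)
      thus "h' 0 w = g u" by simp
    qed
    show "g (s *s u + w) = (\<Sum>i\<le>d. s ^ (d - i) * h' i w)" for s w
    proof -
      have "hom (g (s *s u + w)) = hom (\<Sum>i\<le>d. s ^ (d - i) * h' i w)"
        by (simp add: h(4) h' hom_distribs)
      thus ?thesis by simp
    qed
  qed
  thus ?thesis by blast
qed

text \<open>
  These coefficients are, up to sign, the elementary symmetric functions of the functionals \<open>l x\<close>.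
  The product over a multiset is expanded one factor at a time; \<open>i = Suc (size A)\<close> is separated
  because there the truncated subtraction \<open>size A - i\<close> would pick a coefficient that does not occur.
\<close>

lemma form_coeff_prod:
  assumes "\<And>x. x \<in># A \<Longrightarrow> (\<forall>v w. l x (v + w) = l x v + l x w) \<and> (\<forall>a v. l x (a *s v) = hom a * l x v)"
    and "i \<le> size A"
  shows "form i (\<lambda>v. coeff (\<Prod>x\<in>#A. [:- l x v, 1:]) (size A - i))"
  using assms
proof (induction A arbitrary: i)
  case empty
  thus ?case using form.const[of 1] by simp
next
  case (add x A)
  let ?P = "\<lambda>v. \<Prod>x\<in>#A. [:- l x v, 1:]"
  have IH: "form j (\<lambda>v. coeff (?P v) (size A - j))" if "j \<le> size A" for j
    using add.IH[of j] add.prems(1) that by auto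
  have deg: "degree (?P v) \<le> size A" for v
    by (induction A) (auto intro: order.trans[OF degree_mult_le] simp del: mult_pCons_left)
  have first: "form i (\<lambda>v. if i = Suc (size A) then 0 else coeff (?P v) (size A - i))"
    using IH[of i] add.prems(2) form_zero by (cases "i = Suc (size A)") auto
  have eq: "coeff (\<Prod>x\<in>#add_mset x A. [:- l x v, 1:]) (size (add_mset x A) - i) =
     (if i = Suc (size A) then 0 else coeff (?P v) (size A - i)) +
     (if i = 0 then 0 else (- l x v) * coeff (?P v) (size A - (i - 1)))" for v
  proof -
    consider "i = 0" | "i = Suc (size A)" | j where "i = Suc j" "j < size A"
      using add.prems(2) by (cases i) force+
    thus ?thesis
    proof cases
      case 1
      thus ?thesis using deg[of v] by (simp add: coeff_eq_0)
    next
      case 2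
      thus ?thesis by simp
    next
      case 3
      hence "Suc (size A) - i = Suc (size A - i)" "size A - (i - 1) = Suc (size A - i)" by auto
      with 3 show ?thesis by simp
    qed
  qed
  show ?case
  proof (cases i)
    case 0
    thus ?thesis unfolding eq using first by simp
  next
    case (Suc j)
    have "form (Suc j) (\<lambda>v. (- l x v) * coeff (?P v) (size A - j))"
      by (rule form.mult) (use add.prems Suc IH[of j] in auto)
    with form.add[OF first this[folded Suc]] show ?thesis unfolding eq using Suc by simp
  qed
qed

section \<open>Linear spaces on systems of forms\<close>

definition dim_ge :: "'v set \<Rightarrow> nat \<Rightarrow> bool" where
  "dim_ge S N \<longleftrightarrow> (\<exists>B\<subseteq>S. finite B \<and> independent B \<and> card B = N)"

lemma dim_ge_mono: "dim_ge S N \<Longrightarrow> N' \<le> N \<Longrightarrow> dim_ge S N'"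
  unfolding dim_ge_def
  by (metis independent_mono obtain_subset_with_card_n order_trans)

lemma dim_geI: "finite B \<Longrightarrow> B \<subseteq> S \<Longrightarrow> independent B \<Longrightarrow> N \<le> card B \<Longrightarrow> dim_ge S N"
  using dim_ge_mono[of S "card B" N] unfolding dim_ge_def by blast

lemma kform_1_linear:
  assumes "kform 1 l"
  shows "l 0 = 0" "l (v + w) = l v + l w" "l (a *s v) = a * l v" "l (v - w) = l v - l w"
proof -
  show *: "l (v + w) = l v + l w" "l (a *s v) = a * l v" for v w a
    using kform_1_additive[OF assms] kform_scale[OF assms, of a v] by simp_all
  show "l 0 = 0" using *(2)[of 0 0] by simp
  show "l (v - w) = l v - l w" using *(1)[of "v - w" w] by simp
qed

lemma dim_ge_kernel:
  assumes l: "kform 1 l" and S: "subspace S" "dim_ge S (Suc N)"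
  shows "subspace {v \<in> S. l v = 0}" "dim_ge {v \<in> S. l v = 0} N"
proof -
  show "subspace {v \<in> S. l v = 0}"
    using S(1) unfolding subspace_def by (auto simp: kform_1_linear[OF l])
  obtain B where B: "B \<subseteq> S" "finite B" "independent B" "card B = Suc N"
    using S(2) unfolding dim_ge_def by blast
  show "dim_ge {v \<in> S. l v = 0} N"
  proof (cases "\<forall>b\<in>B. l b = 0")
    case True
    thus ?thesis using B by (intro dim_geI[of B]) auto
  next
    case False
    then obtain b0 where b0: "b0 \<in> B" "l b0 \<noteq> 0" by blast
    obtain C where C: "C \<subseteq> {v \<in> span B. l v = 0}" "independent C" "{v \<in> span B. l v = 0} \<subseteq> span C"
      using maximal_independent_subset by blast
    have "finite C" using independent_span_bound[OF B(2) C(2)] C(1) by blast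
    have "B \<subseteq> span (insert b0 C)"
    proof
      fix b assume b: "b \<in> B"
      have "b - (l b / l b0) *s b0 \<in> span B"
        using b b0 by (intro span_diff span_scale span_base)
      hence "b - (l b / l b0) *s b0 \<in> span C"
        using C(3) b0 by (auto simp: kform_1_linear[OF l])
      hence "b - (l b / l b0) *s b0 \<in> span (insert b0 C)"
        using span_mono[of C "insert b0 C"] by blast
      hence "(b - (l b / l b0) *s b0) + (l b / l b0) *s b0 \<in> span (insert b0 C)"
        by (intro span_add span_scale span_base[of b0]) auto
      thus "b \<in> span (insert b0 C)" by simp
    qed
    hence "card B \<le> card (insert b0 C)"
      using independent_span_bound[of "insert b0 C" B] B(3) \<open>finite C\<close> by blast
    hence "N \<le> card C" using card_insert_le_m1[of "Suc (card C)" C b0] B(4) \<open>finite C\<close>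
      by (simp add: card_insert_if split: if_splits)
    moreover have "C \<subseteq> {v \<in> S. l v = 0}"
      using C(1) span_minimal[OF B(1) S(1)] by blast
    ultimately show ?thesis using \<open>finite C\<close> C(2) by (intro dim_geI[of C])
  qed
qed

lemma dim_ge_complement:
  assumes S: "subspace S" "dim_ge S (Suc N)" and a: "a \<in> S" "a \<noteq> 0"
  obtains S' where "subspace S'" "S' \<subseteq> S" "a \<notin> S'" "dim_ge S' N"
proof -
  obtain B where B: "B \<subseteq> S" "finite B" "independent B" "card B = Suc N"
    using S(2) unfolding dim_ge_def by blast
  obtain C where C: "{a} \<subseteq> C" "C \<subseteq> insert a B" "independent C" "insert a B \<subseteq> span C"
    using maximal_independent_subset_extend[of "{a}" "insert a B"] a(2) by auto
  have "finite C" using C(2) B(2) finite_subset by blast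
  hence "Suc N \<le> card C" using independent_span_bound[of C B] B C(4) by auto
  hence "N \<le> card (C - {a})" using C(1) \<open>finite C\<close> by (simp add: card_Diff_singleton)
  show thesis
  proof (rule that[of "span (C - {a})"])
    show "span (C - {a}) \<subseteq> S"
      by (rule span_minimal) (use C(2) B(1) S(1) in auto)
    show "a \<notin> span (C - {a})" using C(1,3) unfolding dependent_def by blast
    show "dim_ge (span (C - {a})) N"
      by (rule dim_geI[of "C - {a}"])
         (use \<open>finite C\<close> \<open>N \<le> card (C - {a})\<close> independent_mono[OF C(3)] in \<open>auto intro: span_base\<close>)
  qed simp
qed

definition vanishes :: "(nat \<times> ('v \<Rightarrow> 'k)) multiset \<Rightarrow> 'v set \<Rightarrow> bool" where
  "vanishes \<Phi> U \<longleftrightarrow> (\<forall>(d, g)\<in>#\<Phi>. \<forall>u\<in>U. g u = 0)"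

text \<open>
  Only the degrees of a system are recorded, and all forms of these degrees are admitted: a system is
  solved by passing to other systems of which only the degrees can be predicted.
\<close>

definition solvable :: "nat multiset \<Rightarrow> nat \<Rightarrow> nat \<Rightarrow> bool" where
  "solvable M m N \<longleftrightarrow> (\<forall>\<Phi> S. image_mset fst \<Phi> = M \<longrightarrow> (\<forall>(d, g)\<in>#\<Phi>. kform d g) \<longrightarrow>
     subspace S \<longrightarrow> dim_ge S N \<longrightarrow>
     (\<exists>B\<subseteq>S. finite B \<and> independent B \<and> card B = m \<and> vanishes \<Phi> (span B)))"

lemma solvableI:
  assumes "\<And>\<Phi> S. image_mset fst \<Phi> = M \<Longrightarrow> (\<And>d g. (d, g) \<in># \<Phi> \<Longrightarrow> kform d g) \<Longrightarrow>
     subspace S \<Longrightarrow> dim_ge S N \<Longrightarrow>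
     \<exists>B\<subseteq>S. finite B \<and> independent B \<and> card B = m \<and> vanishes \<Phi> (span B)"
  shows "solvable M m N"
  unfolding solvable_def using assms by blast

lemma solvableD:
  assumes "solvable M m N" "image_mset fst \<Phi> = M" "\<And>d g. (d, g) \<in># \<Phi> \<Longrightarrow> kform d g"
    "subspace S" "dim_ge S N"
  obtains B where "B \<subseteq> S" "finite B" "independent B" "card B = m" "vanishes \<Phi> (span B)"
  using assms unfolding solvable_def by blast

lemma solvable_mono: "solvable M m N \<Longrightarrow> N \<le> N' \<Longrightarrow> solvable M m N'"
  unfolding solvable_def using dim_ge_mono by blast

lemma solvable_empty: "solvable {#} m m"
  by (rule solvableI) (auto simp: dim_ge_def vanishes_def)

lemma image_mset_fst_eq_add_mset:
  assumes "image_mset fst \<Phi> = add_mset d M"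
  obtains g \<Psi> where "\<Phi> = add_mset (d, g) \<Psi>" "image_mset fst \<Psi> = M"
proof -
  from msed_map_invR[OF assms] obtain \<Psi> x where "\<Phi> = add_mset x \<Psi>" "fst x = d" "image_mset fst \<Psi> = M"
    by blast
  thus thesis using that[of "snd x" \<Psi>] by auto
qed

lemma solvable_linear:
  assumes "solvable M m N"
  shows "solvable (add_mset 1 M) m (Suc N)"
proof (rule solvableI)
  fix \<Phi> :: "(nat \<times> ('v \<Rightarrow> 'k)) multiset" and S
  assume \<Phi>: "image_mset fst \<Phi> = add_mset 1 M" "\<And>d g. (d, g) \<in># \<Phi> \<Longrightarrow> kform d g"
    and S: "subspace S" "dim_ge S (Suc N)"
  from \<Phi>(1) obtain \<Psi> l where \<Psi>: "\<Phi> = add_mset (1, l) \<Psi>" "image_mset fst \<Psi> = M"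
    by (rule image_mset_fst_eq_add_mset)
  have l: "kform 1 l" using \<Phi>(2) \<Psi>(1) by simp
  note S' = dim_ge_kernel[OF l S]
  obtain B where B: "B \<subseteq> {v \<in> S. l v = 0}" "finite B" "independent B" "card B = m" "vanishes \<Psi> (span B)"
    using solvableD[OF assms \<Psi>(2) _ S'] \<Phi>(2) \<Psi>(1) by auto
  have "span B \<subseteq> {v \<in> S. l v = 0}" by (rule span_minimal[OF B(1) S'(1)])
  hence "vanishes \<Phi> (span B)" using B(5) by (auto simp: vanishes_def \<Psi>(1))
  with B show "\<exists>B\<subseteq>S. finite B \<and> independent B \<and> card B = m \<and> vanishes \<Phi> (span B)" by blast
qed

lemma vanishes_span_singleton:
  assumes "\<And>d g. (d, g) \<in># \<Phi> \<Longrightarrow> kform d g \<and> g t = 0 \<and> 0 < d"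
  shows "vanishes \<Phi> (span {t})"
  unfolding vanishes_def span_singleton
proof (intro ballI, clarify)
  fix d g c
  assume "(d, g) \<in># \<Phi>"
  from assms[OF this] show "g (c *s t) = 0" using kform_scale[of d g c t] by simp
qed

text \<open>
  On the line spanned by \<open>u\<close> and \<open>w\<close> the form becomes, at the points \<open>su + w\<close>, a polynomial of degree \<open>d\<close>
  in the variable \<open>s\<close>, unless it vanishes at \<open>u\<close> itself.
\<close>

lemma solvable_univariate:
  assumes M: "solvable M 2 N" and d: "1 \<le> d" "d \<le> D"
  shows "solvable (add_mset d M) 1 N"
proof (rule solvableI)
  fix \<Phi> :: "(nat \<times> ('v \<Rightarrow> 'k)) multiset" and S
  assume \<Phi>: "image_mset fst \<Phi> = add_mset d M" "\<And>d g. (d, g) \<in># \<Phi> \<Longrightarrow> kform d g"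
    and S: "subspace S" "dim_ge S N"
  from \<Phi>(1) obtain \<Psi> f where \<Psi>: "\<Phi> = add_mset (d, f) \<Psi>" "image_mset fst \<Psi> = M"
    by (rule image_mset_fst_eq_add_mset)
  have f: "kform d f" using \<Phi>(2) \<Psi>(1) by simp
  obtain B where B: "B \<subseteq> S" "finite B" "independent B" "card B = 2" "vanishes \<Psi> (span B)"
    using solvableD[OF M \<Psi>(2) _ S] \<Phi>(2) \<Psi>(1) by auto
  obtain u w where uw: "B = {u, w}" "u \<noteq> w" using B(4) by (auto simp: card_2_iff)
  have "\<exists>t\<in>span B. t \<noteq> 0 \<and> f t = 0"
  proof (cases "f u = 0")
    case True
    thus ?thesis using B(3) dependent_zero[of B] uw(1) by (intro bexI[of _ u]) (auto intro: span_base)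
  next
    case False
    obtain h where "polars d f u h" using polars_exist[OF f] by blast
    note h = polarsD(2,3)[OF this]
    define P where "P = (\<Sum>i\<le>d. monom (h i w) (d - i))"
    have "coeff P d = (\<Sum>i\<le>d. if i = 0 then h i w else 0)"
      unfolding P_def coeff_sum by (rule sum.cong) (use d in auto)
    hence "coeff P d \<noteq> 0" using False by (simp add: h(1))
    hence "d \<le> degree P" by (rule le_degree)
    moreover have "degree P \<le> d"
      unfolding P_def by (rule degree_sum_le) (auto intro: order.trans[OF degree_monom_le])
    ultimately obtain s where s: "poly P s = 0" using ex_root[of P] d by auto
    have "f (s *s u + w) = 0"
      using s by (simp add: h(2) P_def poly_sum poly_monom mult_ac)
    moreover have "s *s u + w \<noteq> 0"
    proof
      assume "s *s u + w = 0"
      hence "w = - (s *s u)" by (simp add: eq_neg_iff_add_eq_0 add.commute)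
      hence "w \<in> span {u}" by (auto intro: span_neg span_scale span_base)
      moreover have "B - {w} = {u}" using uw by auto
      ultimately show False using B(3) uw unfolding dependent_def by auto
    qed
    moreover have "s *s u + w \<in> span B" unfolding uw(1) by (intro span_add span_scale span_base) auto
    ultimately show ?thesis by blast
  qed
  then obtain t where t: "t \<in> span B" "t \<noteq> 0" "f t = 0" by blast
  have "span {t} \<subseteq> span B" using t(1) by (intro span_minimal) auto
  hence "vanishes \<Psi> (span {t})" using B(5) unfolding vanishes_def by blast
  moreover have "vanishes {#(d, f)#} (span {t})"
    by (rule vanishes_span_singleton) (use f t d in auto)
  ultimately have "vanishes \<Phi> (span {t})" by (auto simp: \<Psi>(1) vanishes_def)
  moreover have "t \<in> S" using t(1) span_minimal[OF B(1) S(1)] by blast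
  ultimately show "\<exists>B\<subseteq>S. finite B \<and> independent B \<and> card B = 1 \<and> vanishes \<Phi> (span B)"
    using t(2) by (intro exI[of _ "{t}"]) auto
qed

text \<open>
  \<open>P\<close> is the equation of the curve that \<open>f\<close> cuts out on the plane spanned by \<open>u\<close>, \<open>v\<close>, \<open>w\<close>,
  in the affine chart where \<open>v\<close> has coordinate 1; the third condition describes it on the line at
  infinity through \<open>u\<close> and \<open>w\<close>, and the last one at the point \<open>w\<close>.
\<close>

definition plane_equation :: "nat \<Rightarrow> ('v \<Rightarrow> 'k) \<Rightarrow> 'v \<Rightarrow> 'v \<Rightarrow> 'v \<Rightarrow> 'k poly poly \<Rightarrow> bool" where
  "plane_equation m f u v w P \<longleftrightarrow> (\<forall>i. coeff P i \<noteq> 0 \<longrightarrow> degree (coeff P i) + i \<le> m) \<and>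
     (\<forall>x z. poly (poly P [:z:]) x = f (z *s w + (x *s u + v))) \<and>
     (\<forall>z. (\<Sum>i\<le>m. coeff (coeff P i) (m - i) * z ^ i) = f (z *s w + u)) \<and>
     coeff P m = [:f w:]"

text \<open>
  The coefficients are found by taking polars at \<open>w\<close> and then polars of these at \<open>u\<close>.
\<close>

lemma plane_equation_exists:
  assumes f: "kform m f"
  shows "\<exists>P. plane_equation m f u v w P"
proof -
  obtain h where "polars m f w h" using polars_exist[OF f] by blast
  note h = polarsD[OF this]
  have "\<forall>i. \<exists>g. polars i (h i) u g" using polars_exist[OF h(1)] by blast
  from choice[OF this] obtain g where "\<And>i. polars i (h i) u (g i)" by blast
  note g = polarsD(2,3)[OF this]
  define C where "C i = (\<Sum>j\<le>i. monom (g i j v) (i - j))" for i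
  have C: "poly (C i) x = h i (x *s u + v)" "degree (C i) \<le> i" "coeff (C i) i = h i u" for i x
  proof -
    show "poly (C i) x = h i (x *s u + v)" by (simp add: C_def g(2) poly_sum poly_monom mult_ac)
    show "degree (C i) \<le> i"
      unfolding C_def by (rule degree_sum_le) (auto intro: order.trans[OF degree_monom_le])
    have "coeff (C i) i = (\<Sum>j\<le>i. if j = 0 then g i j v else 0)"
      unfolding C_def coeff_sum by (rule sum.cong) auto
    thus "coeff (C i) i = h i u" by (simp add: g(1))
  qed
  define P where "P = (\<Sum>i\<le>m. monom (C i) (m - i))"
  have coeff_P: "coeff P i = (if i \<le> m then C (m - i) else 0)" for i
  proof -
    have "coeff P i = (\<Sum>j\<le>m. if m - j = i then C j else 0)"
      by (simp add: P_def coeff_sum)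
    also have "\<dots> = (\<Sum>j\<le>m. if j = m - i then (if i \<le> m then C (m - i) else 0) else 0)"
      by (rule sum.cong) auto
    finally show ?thesis by simp
  qed
  have "plane_equation m f u v w P"
    unfolding plane_equation_def
  proof (intro conjI allI impI)
    show "degree (coeff P i) + i \<le> m" if "coeff P i \<noteq> 0" for i
      using that C(2)[of "m - i"] by (auto simp: coeff_P split: if_splits)
    show "poly (poly P [:z:]) x = f (z *s w + (x *s u + v))" for x z
      by (simp add: P_def poly_sum poly_monom h(3) C mult_ac)
    show "(\<Sum>i\<le>m. coeff (coeff P i) (m - i) * z ^ i) = f (z *s w + u)" for z
    proof -
      have "(\<Sum>i\<le>m. coeff (coeff P i) (m - i) * z ^ i) = (\<Sum>i\<le>m. h (m - i) u * z ^ i)"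
        by (rule sum.cong) (simp_all add: coeff_P C(3))
      also have "\<dots> = (\<Sum>i\<le>m. z ^ (m - i) * h i u)"
        by (rule sum.reindex_bij_witness[of _ "\<lambda>i. m - i" "\<lambda>i. m - i"]) (auto simp: mult.commute)
      finally show ?thesis by (simp add: h(3))
    qed
    show "coeff P m = [:f w:]"
      by (simp add: coeff_P C_def h(2) g(1) monom_0)
  qed
  thus ?thesis by blast
qed

text \<open>
  A common zero of the two plane curves, either in the affine chart of the plane equations or on the
  line at infinity; if both forms vanish at \<open>w\<close>, then \<open>w\<close> itself is one.
\<close>

lemma solvable_plane:
  assumes M: "solvable M 3 N" and mn: "1 \<le> m" "1 \<le> n" "m * n \<le> D"
  shows "solvable (add_mset m (add_mset n M)) 1 N"
proof (rule solvableI)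
  fix \<Phi> :: "(nat \<times> ('v \<Rightarrow> 'k)) multiset" and S
  assume \<Phi>: "image_mset fst \<Phi> = add_mset m (add_mset n M)" "\<And>d g. (d, g) \<in># \<Phi> \<Longrightarrow> kform d g"
    and S: "subspace S" "dim_ge S N"
  from \<Phi>(1) obtain \<Psi>' f where *: "\<Phi> = add_mset (m, f) \<Psi>'" "image_mset fst \<Psi>' = add_mset n M"
    by (rule image_mset_fst_eq_add_mset)
  from *(2) obtain \<Psi> g where "\<Psi>' = add_mset (n, g) \<Psi>" and **: "image_mset fst \<Psi> = M"
    by (rule image_mset_fst_eq_add_mset)
  with * have \<Psi>: "\<Phi> = add_mset (m, f) (add_mset (n, g) \<Psi>)" "image_mset fst \<Psi> = M" by simp_all
  have f: "kform m f" and g: "kform n g" using \<Phi>(2) \<Psi>(1) by simp_all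
  obtain B where B: "B \<subseteq> S" "finite B" "independent B" "card B = 3" "vanishes \<Psi> (span B)"
    using solvableD[OF M \<Psi>(2) _ S] \<Phi>(2) \<Psi>(1) by auto
  obtain u v w where uvw: "B = {u, v, w}" "u \<noteq> v" "u \<noteq> w" "v \<noteq> w"
    using B(4) unfolding card_3_iff by blast
  have in_span: "u \<in> span B" "v \<in> span B" "w \<in> span B" unfolding uvw(1) by (auto intro: span_base)
  have "\<exists>t\<in>span B. t \<noteq> 0 \<and> f t = 0 \<and> g t = 0"
  proof (cases "f w = 0 \<and> g w = 0")
    case True
    moreover have "w \<noteq> 0" using B(3) dependent_zero[of B] uvw(1) by auto
    ultimately show ?thesis using in_span(3) by blast
  next
    case False
    obtain P where P: "plane_equation m f u v w P" using plane_equation_exists[OF f] by blast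
    obtain Q where Q: "plane_equation n g u v w Q" using plane_equation_exists[OF g] by blast
    have "(\<exists>x z. poly (poly P [:z:]) x = 0 \<and> poly (poly Q [:z:]) x = 0) \<or>
      (\<exists>z. (\<Sum>i\<le>m. coeff (coeff P i) (m - i) * z ^ i) = 0 \<and>
           (\<Sum>i\<le>n. coeff (coeff Q i) (n - i) * z ^ i) = 0)"
      by (rule plane_curves_meet) (use P Q mn False in \<open>auto simp: plane_equation_def\<close>)
    moreover have "poly (poly P [:z:]) x = f (z *s w + (x *s u + v))"
      "poly (poly Q [:z:]) x = g (z *s w + (x *s u + v))"
      "(\<Sum>i\<le>m. coeff (coeff P i) (m - i) * z ^ i) = f (z *s w + u)"
      "(\<Sum>i\<le>n. coeff (coeff Q i) (n - i) * z ^ i) = g (z *s w + u)" for x z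
      using P Q unfolding plane_equation_def by blast+
    ultimately consider x z where "f (z *s w + (x *s u + v)) = 0" "g (z *s w + (x *s u + v)) = 0"
      | z where "f (z *s w + u) = 0" "g (z *s w + u) = 0"
      by force
    thus ?thesis
    proof cases
      case 1
      have "z *s w + (x *s u + v) \<noteq> 0"
      proof
        assume "z *s w + (x *s u + v) = 0"
        hence "(z *s w + x *s u) + v = 0" by (simp add: add.assoc)
        hence "v = - (z *s w + x *s u)" by (simp only: add_eq_0_iff)
        moreover have "- (z *s w + x *s u) \<in> span {u, w}"
          by (intro span_neg span_add span_scale span_base) auto
        ultimately have "v \<in> span {u, w}" by (simp only:)
        moreover have "B - {v} = {u, w}" using uvw by auto
        ultimately show False using B(3) uvw(1) unfolding dependent_def by auto
      qed
      moreover have "z *s w + (x *s u + v) \<in> span B" by (intro span_add span_scale in_span)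
      ultimately show ?thesis using 1 by blast
    next
      case 2
      have "z *s w + u \<noteq> 0"
      proof
        assume "z *s w + u = 0"
        hence "u = - (z *s w)" by (simp only: add_eq_0_iff)
        moreover have "- (z *s w) \<in> span {v, w}"
          by (intro span_neg span_scale span_base) auto
        ultimately have "u \<in> span {v, w}" by (simp only:)
        moreover have "B - {u} = {v, w}" using uvw by auto
        ultimately show False using B(3) uvw(1) unfolding dependent_def by auto
      qed
      moreover have "z *s w + u \<in> span B" by (intro span_add span_scale in_span)
      ultimately show ?thesis using 2 by blast
    qed
  qed
  then obtain t where t: "t \<in> span B" "t \<noteq> 0" "f t = 0" "g t = 0" by blast
  have "span {t} \<subseteq> span B" using t(1) by (intro span_minimal) auto
  hence "vanishes \<Psi> (span {t})" using B(5) unfolding vanishes_def by blast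
  moreover have "vanishes {#(m, f), (n, g)#} (span {t})"
    by (rule vanishes_span_singleton) (use f g t mn in auto)
  ultimately have "vanishes \<Phi> (span {t})" by (auto simp: \<Psi>(1) vanishes_def)
  moreover have "t \<in> S" using t(1) span_minimal[OF B(1) S(1)] by blast
  ultimately show "\<exists>B\<subseteq>S. finite B \<and> independent B \<and> card B = 1 \<and> vanishes \<Phi> (span B)"
    using t(2) by (intro exI[of _ "{t}"]) auto
qed

definition polar_degrees :: "nat multiset \<Rightarrow> nat multiset" where
  "polar_degrees M = (\<Sum>d\<in>#M. mset [1..<Suc d])"

text \<open>
  The step of Sylvester's obliteration. If all forms of the system vanish at \<open>a\<close>, and all their polars
  at \<open>a\<close> vanish on a subspace \<open>U\<close>, then all forms vanish on \<open>\<langle>a\<rangle> + U\<close>. Searching for \<open>U\<close> in a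
  complement of \<open>a\<close> makes the dimension grow, at the price of one dimension of the ambient space.
  The polar of degree 0 needs no attention: it is the constant \<open>g(a) = 0\<close>.
\<close>

lemma solvable_obliterate:
  assumes pt: "solvable M 1 (Suc N)" and rest: "solvable (polar_degrees M) m N"
  shows "solvable M (Suc m) (Suc N)"
proof (rule solvableI)
  fix \<Phi> :: "(nat \<times> ('v \<Rightarrow> 'k)) multiset" and S
  assume \<Phi>: "image_mset fst \<Phi> = M" "\<And>d g. (d, g) \<in># \<Phi> \<Longrightarrow> kform d g"
    and S: "subspace S" "dim_ge S (Suc N)"
  obtain A where A: "A \<subseteq> S" "independent A" "card A = 1" "vanishes \<Phi> (span A)"
    using solvableD[OF pt \<Phi> S] by blast
  obtain a where "A = {a}" using A(3) by (auto simp: card_1_singleton_iff)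
  with A have a: "a \<in> S" "a \<noteq> 0" by auto
  obtain S' where S': "subspace S'" "S' \<subseteq> S" "a \<notin> S'" "dim_ge S' N"
    using dim_ge_complement[OF S a] by blast
  have "\<forall>x\<in>#\<Phi>. \<exists>h. polars (fst x) (snd x) a h"
  proof
    fix x assume "x \<in># \<Phi>"
    hence "kform (fst x) (snd x)" using \<Phi>(2) by (cases x) auto
    thus "\<exists>h. polars (fst x) (snd x) a h" by (rule polars_exist)
  qed
  from bchoice[OF this] obtain h where h: "\<And>x. x \<in># \<Phi> \<Longrightarrow> polars (fst x) (snd x) a (h x)" by blast
  define \<Psi> where "\<Psi> = (\<Sum>x\<in>#\<Phi>. image_mset (\<lambda>i. (i, h x i)) (mset [1..<Suc (fst x)]))"
  have "image_mset fst (\<Sum>x\<in>#A. image_mset (\<lambda>i. (i, h x i)) (mset [1..<Suc (fst x)]))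
      = polar_degrees (image_mset fst A)" for A
    by (induction A) (simp_all add: polar_degrees_def image_mset.compositionality o_def)
  hence fst_\<Psi>: "image_mset fst \<Psi> = polar_degrees M" unfolding \<Psi>_def \<Phi>(1)[symmetric] .
  have in_\<Psi>: "y \<in># \<Psi> \<longleftrightarrow> (\<exists>x\<in>#\<Phi>. \<exists>i\<in>{1..<Suc (fst x)}. y = (i, h x i))" for y
    unfolding \<Psi>_def by (simp add: image_iff del: upt_Suc)
  have kform_\<Psi>: "kform d g" if "(d, g) \<in># \<Psi>" for d g
    using that polarsD(1)[OF h] unfolding in_\<Psi> by blast
  obtain B where B: "B \<subseteq> S'" "finite B" "independent B" "card B = m" "vanishes \<Psi> (span B)"
    using solvableD[OF rest fst_\<Psi> kform_\<Psi> S'(1,4)] by blast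
  have "a \<notin> span B" using span_minimal[OF B(1) S'(1)] S'(3) by blast
  hence "a \<notin> B" by (auto intro: span_base)
  have "vanishes \<Phi> (span (insert a B))"
    unfolding vanishes_def
  proof (intro ballI, clarify)
    fix d g u assume dg: "(d, g) \<in># \<Phi>" and "u \<in> span (insert a B)"
    then obtain s where "u - s *s a \<in> span B" unfolding span_insert by blast
    moreover define w where "w = u - s *s a"
    ultimately have w: "w \<in> span B" "u = s *s a + w" by simp_all
    have "\<forall>u\<in>span A. g u = 0" using A(4) dg unfolding vanishes_def by auto
    hence "g a = 0" using span_base[of a A] \<open>A = {a}\<close> by blast
    have "g u = (\<Sum>i\<le>d. s ^ (d - i) * h (d, g) i w)" using polarsD(3)[OF h[OF dg]] w(2) by simp
    also have "\<dots> = 0"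
    proof (rule sum.neutral, rule ballI)
      fix i assume i: "i \<in> {..d}"
      show "s ^ (d - i) * h (d, g) i w = 0"
      proof (cases "i = 0")
        case True
        thus ?thesis using polarsD(2)[OF h[OF dg]] \<open>g a = 0\<close> by simp
      next
        case False
        hence "(i, h (d, g) i) \<in># \<Psi>"
          unfolding in_\<Psi> using dg i by (intro bexI[of _ "(d, g)"] bexI[of _ i]) auto
        thus ?thesis using B(5) w(1) unfolding vanishes_def by auto
      qed
    qed
    finally show "g u = 0" .
  qed
  moreover have "independent (insert a B)"
    using \<open>a \<notin> span B\<close> B(3) by (rule independent_insertI)
  ultimately show "\<exists>B\<subseteq>S. finite B \<and> independent B \<and> card B = Suc m \<and> vanishes \<Phi> (span B)"
    using B(1,2,4) S'(2) a(1) \<open>a \<notin> B\<close> by (intro exI[of _ "insert a B"]) auto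
qed

lemma polar_degrees_simps:
  "polar_degrees {#} = {#}"
  "polar_degrees (add_mset 1 M) = add_mset 1 (polar_degrees M)"
  "polar_degrees (add_mset 2 M) = add_mset 2 (add_mset 1 (polar_degrees M))"
  "polar_degrees (add_mset 3 M) = add_mset 3 (add_mset 2 (add_mset 1 (polar_degrees M)))"
  by (simp_all add: polar_degrees_def upt_rec numeral_eq_Suc)

lemma solvable_add_linear:
  assumes "solvable M m N" "M' = replicate_mset r 1 + M" "N' = r + N"
  shows "solvable M' m N'"
proof -
  have "solvable (replicate_mset r 1 + M) m (r + N)"
    using assms(1) by (induction r) (auto dest: solvable_linear)
  thus ?thesis using assms(2,3) by simp
qed

text \<open>
  The count of dimensions. The statements \<open>pt\<close> and \<open>line\<close> say that the system of the named degrees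
  has a common zero, or vanishes on a 2-dimensional space. The polars of a cubic and a quadric are a
  cubic, two quadrics and two linear forms; the polars of these are a cubic, three quadrics and five
  linear forms. Every system is reduced to its quadrics: these are made to vanish on a 2-dimensional
  space, where the cubic or the last quadric is a polynomial in one variable. So the cubic and
  the quadric vanish on a 3-dimensional space, on which the quartic and the quintic define
  plane curves. This intersection is the only place that needs roots of degree 20.
\<close>

lemma solvable_1_to_5:
  assumes "20 \<le> D"
  shows "solvable {#1, 2, 3, 4, 5#} 1 19"
proof -
  have pt_2: "solvable {#2#} 1 2"
    using solvable_univariate[OF solvable_empty, of 2] assms by simp
  have line_2: "solvable {#2#} 2 4"
  proof -
    have "solvable (polar_degrees {#2#}) 1 3"
      by (rule solvable_add_linear[OF pt_2, of _ 1])
        (unfold polar_degrees_simps, simp_all add: add_mset_commute numeral_eq_Suc)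
    from solvable_obliterate[OF solvable_mono[OF pt_2] this] show ?thesis
      by (simp flip: numeral_2_eq_2)
  qed
  have pt_22: "solvable {#2, 2#} 1 4"
    using solvable_univariate[OF line_2, of 2] assms by simp
  have line_22: "solvable {#2, 2#} 2 7"
  proof -
    have "solvable (polar_degrees {#2, 2#}) 1 6"
      by (rule solvable_add_linear[OF pt_22, of _ 2])
        (unfold polar_degrees_simps, simp_all add: add_mset_commute numeral_eq_Suc)
    from solvable_obliterate[OF solvable_mono[OF pt_22] this] show ?thesis
      by (simp flip: numeral_2_eq_2)
  qed
  have pt_222: "solvable {#2, 2, 2#} 1 7"
    using solvable_univariate[OF line_22, of 2] assms by simp
  have line_222: "solvable {#2, 2, 2#} 2 11"
  proof -
    have "solvable (polar_degrees {#2, 2, 2#}) 1 10"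
      by (rule solvable_add_linear[OF pt_222, of _ 3])
        (unfold polar_degrees_simps, simp_all add: add_mset_commute numeral_eq_Suc)
    from solvable_obliterate[OF solvable_mono[OF pt_222] this] show ?thesis
      by (simp flip: numeral_2_eq_2)
  qed
  have pt_32: "solvable {#3, 2#} 1 4"
    using solvable_univariate[OF line_2, of 3] assms by simp
  have pt_322: "solvable {#3, 2, 2#} 1 7"
    using solvable_univariate[OF line_22, of 3] assms by simp
  have pt_3222: "solvable {#3, 2, 2, 2#} 1 11"
    using solvable_univariate[OF line_222, of 3] assms by simp
  have line_polar_32: "solvable (polar_degrees {#3, 2#}) 2 17"
  proof -
    have pt: "solvable (polar_degrees {#3, 2#}) 1 9"
      by (rule solvable_add_linear[OF pt_322, of _ 2])
        (unfold polar_degrees_simps, simp_all add: add_mset_commute numeral_eq_Suc)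
    have "solvable (polar_degrees (polar_degrees {#3, 2#})) 1 16"
      by (rule solvable_add_linear[OF pt_3222, of _ 5])
        (unfold polar_degrees_simps, simp_all add: add_mset_commute numeral_eq_Suc)
    from solvable_obliterate[OF solvable_mono[OF pt] this] show ?thesis
      by (simp flip: numeral_2_eq_2)
  qed
  have "solvable {#3, 2#} 3 18"
    using solvable_obliterate[OF solvable_mono[OF pt_32] line_polar_32] by (simp flip: numeral_3_eq_3)
  from solvable_plane[OF this, of 4 5] assms have "solvable {#4, 5, 3, 2#} 1 18" by simp
  from solvable_linear[OF this] show ?thesis by (simp add: add_mset_commute)
qed

end

section \<open>Towers of fields\<close>

lemma subfield_generate_field:
  fixes H :: "'a::field set"
  shows "1 \<in> generate_field ring_of_type_algebra H"
    and "x \<in> generate_field ring_of_type_algebra H \<Longrightarrow> y \<in> generate_field ring_of_type_algebra H \<Longrightarrow>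
      x + y \<in> generate_field ring_of_type_algebra H"
    and "x \<in> generate_field ring_of_type_algebra H \<Longrightarrow> y \<in> generate_field ring_of_type_algebra H \<Longrightarrow>
      x * y \<in> generate_field ring_of_type_algebra H"
    and "x \<in> generate_field ring_of_type_algebra H \<Longrightarrow> - x \<in> generate_field ring_of_type_algebra H"
    and "x \<in> generate_field ring_of_type_algebra H \<Longrightarrow> inverse x \<in> generate_field ring_of_type_algebra H"
proof -
  let ?R = "ring_of_type_algebra :: 'a ring"
  interpret R: field ?R by (rule field_from_type_algebra)
  have ops: "\<one>\<^bsub>?R\<^esub> = 1" "\<zero>\<^bsub>?R\<^esub> = 0" "x \<oplus>\<^bsub>?R\<^esub> y = x + y" "x \<otimes>\<^bsub>?R\<^esub> y = x * y" "carrier ?R = UNIV" for x y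
    by (simp_all add: ring_of_type_algebra_def)
  have minus: "\<ominus>\<^bsub>?R\<^esub> x = - x" for x
    by (rule R.minus_equality) (simp_all add: ops)
  have inv: "inv\<^bsub>?R\<^esub> x = inverse x" if "x \<noteq> 0" for x
    by (rule R.comm_inv_char) (use that in \<open>simp_all add: ops\<close>)
  show "1 \<in> generate_field ?R H" using generate_field.one[of ?R H] by (simp add: ops)
  show "x + y \<in> generate_field ?R H" if "x \<in> generate_field ?R H" "y \<in> generate_field ?R H"
    using generate_field.eng_add[OF that] by (simp add: ops)
  show "x * y \<in> generate_field ?R H" if "x \<in> generate_field ?R H" "y \<in> generate_field ?R H"
    using generate_field.eng_mult[OF that] by (simp add: ops)
  show *: "- x \<in> generate_field ?R H" if "x \<in> generate_field ?R H" for x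
    using generate_field.a_inv[OF that] by (simp add: minus)
  show "inverse x \<in> generate_field ?R H" if "x \<in> generate_field ?R H"
    using generate_field.m_inv[OF that] that by (cases "x = 0") (simp_all add: inv ops)
qed

lemma generate_field_mono_insert:
  fixes H :: "'a::field set"
  assumes "H \<subseteq> H'"
  shows "generate_field ring_of_type_algebra H \<subseteq> generate_field ring_of_type_algebra H'"
  by (rule field.mono_generate_field[OF field_from_type_algebra assms])
     (simp add: ring_of_type_algebra_def)

definition field_closed :: "'a::field set \<Rightarrow> bool" where
  "field_closed L \<longleftrightarrow> 0 \<in> L \<and> 1 \<in> L \<and> (\<forall>x\<in>L. \<forall>y\<in>L. x + y \<in> L \<and> x * y \<in> L) \<and>
     (\<forall>x\<in>L. - x \<in> L \<and> inverse x \<in> L)"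

lemma field_closed_generate_field: "field_closed (generate_field ring_of_type_algebra H)"
proof -
  note G = subfield_generate_field[where H = H]
  have "1 + (- 1) \<in> generate_field ring_of_type_algebra H" by (intro G)
  thus ?thesis unfolding field_closed_def by (auto intro: G)
qed

lemma field_closed_solvable_tower:
  "solvable_tower d K L \<Longrightarrow> field_closed K \<Longrightarrow> field_closed L"
  by (induction rule: solvable_tower.induct) (auto intro: field_closed_generate_field)

lemma subset_solvable_tower: "solvable_tower d K L \<Longrightarrow> K \<subseteq> L"
  by (induction rule: solvable_tower.induct) (auto intro: generate_field.incl)

text \<open>
  Compositum of two towers: the adjunctions of the second are repeated on top of the first.
\<close>

lemma solvable_tower_common:
  assumes "solvable_tower d K L1" "solvable_tower d K L2"
  shows "\<exists>L. solvable_tower d K L \<and> L1 \<subseteq> L \<and> L2 \<subseteq> L"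
  using assms(2)
proof (induction rule: solvable_tower.induct)
  case base
  show ?case using assms(1) subset_solvable_tower by blast
next
  case (adjoin L2 f a)
  then obtain L where L: "solvable_tower d K L" "L1 \<subseteq> L" "L2 \<subseteq> L" by blast
  have "solvable_tower d K (generate_field ring_of_type_algebra (insert a L))"
    by (rule solvable_tower.adjoin[OF L(1) adjoin.hyps(2,3) _ adjoin.hyps(5)])
       (use adjoin.hyps(4) L(3) in auto)
  moreover have "L1 \<subseteq> generate_field ring_of_type_algebra (insert a L)"
    using L(2) by (auto intro: generate_field.incl)
  moreover have "generate_field ring_of_type_algebra (insert a L2)
      \<subseteq> generate_field ring_of_type_algebra (insert a L)"
    by (rule generate_field_mono_insert) (use L(3) in auto)
  ultimately show ?case by blast
qed

lemma solvable_tower_finite: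
  assumes "finite A" "\<And>x. x \<in> A \<Longrightarrow> \<exists>L. solvable_tower d K L \<and> x \<in> L"
  shows "\<exists>L. solvable_tower d K L \<and> A \<subseteq> L"
  using assms
proof (induction A rule: finite_induct)
  case empty
  show ?case using solvable_tower.base by blast
next
  case (insert x A)
  obtain L1 where L1: "solvable_tower d K L1" "A \<subseteq> L1" using insert by auto
  obtain L2 where L2: "solvable_tower d K L2" "x \<in> L2" using insert by auto
  from solvable_tower_common[OF L1(1) L2(1)] L1(2) L2(2) show ?case by blast
qed

lemma field_closed_range_to_ac: "field_closed (range (to_ac :: 'a::field \<Rightarrow> 'a alg_closure))"
  unfolding field_closed_def
  by (auto simp flip: to_ac_0 to_ac_1 to_ac_add to_ac_mult to_ac_minus to_ac_inverse)

text \<open>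
  The union of all towers, made a type so that linear algebra and polynomials over it are available.
  It depends only on the ground field, hence only on the type \<open>'a\<close>.
\<close>

typedef (overloaded) 'a :: field tower_closure =
  "{x :: 'a alg_closure. \<exists>L. solvable_tower 20 (range to_ac) L \<and> x \<in> L}"
  using field_closed_range_to_ac unfolding field_closed_def by (blast intro: solvable_tower.base)

lemma tower_closure_ops:
  fixes x y :: "'a::field alg_closure"
  defines "C \<equiv> {x :: 'a alg_closure. \<exists>L. solvable_tower 20 (range to_ac) L \<and> x \<in> L}"
  shows "0 \<in> C" "1 \<in> C" "x \<in> C \<Longrightarrow> y \<in> C \<Longrightarrow> x + y \<in> C" "x \<in> C \<Longrightarrow> y \<in> C \<Longrightarrow> x * y \<in> C"
    "x \<in> C \<Longrightarrow> - x \<in> C" "x \<in> C \<Longrightarrow> inverse x \<in> C"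
    "x \<in> C \<Longrightarrow> y \<in> C \<Longrightarrow> x - y \<in> C" "x \<in> C \<Longrightarrow> y \<in> C \<Longrightarrow> x / y \<in> C"
proof -
  have closed: "field_closed L" if "solvable_tower 20 (range to_ac) L" for L :: "'a alg_closure set"
    using field_closed_solvable_tower[OF that field_closed_range_to_ac] .
  have base: "solvable_tower 20 (range to_ac) (range (to_ac :: 'a \<Rightarrow> _))" by (rule solvable_tower.base)
  have pair: "\<exists>L. solvable_tower 20 (range to_ac) L \<and> field_closed L \<and> x \<in> L \<and> y \<in> L"
    if xy: "x \<in> C" "y \<in> C" for x y
  proof -
    obtain L1 L2 where "solvable_tower 20 (range to_ac) L1" "x \<in> L1"
      "solvable_tower 20 (range to_ac) L2" "y \<in> L2" using xy unfolding C_def by blast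
    with solvable_tower_common[of 20 "range to_ac" L1 L2] closed show ?thesis by blast
  qed
  show "0 \<in> C" "1 \<in> C" using closed[OF base] base unfolding C_def field_closed_def by blast+
  show add: "x + y \<in> C" if "x \<in> C" "y \<in> C" for x y
    using pair[OF that] unfolding C_def field_closed_def by blast
  show mult: "x * y \<in> C" if "x \<in> C" "y \<in> C" for x y
    using pair[OF that] unfolding C_def field_closed_def by blast
  show uminus: "- x \<in> C" if "x \<in> C" for x
    using pair[OF that that] unfolding C_def field_closed_def by blast
  show inverse: "inverse x \<in> C" if "x \<in> C" for x
    using pair[OF that that] unfolding C_def field_closed_def by blast
  show "x - y \<in> C" if "x \<in> C" "y \<in> C"
    using add[OF that(1) uminus[OF that(2)]] by simp
  show "x / y \<in> C" if "x \<in> C" "y \<in> C"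
    using mult[OF that(1) inverse[OF that(2)]] by (simp add: divide_inverse)
qed

setup_lifting type_definition_tower_closure

instantiation tower_closure :: (field) field
begin

lift_definition zero_tower_closure :: "'a tower_closure" is 0 by (rule tower_closure_ops[simplified mem_Collect_eq])
lift_definition one_tower_closure :: "'a tower_closure" is 1 by (rule tower_closure_ops[simplified mem_Collect_eq])
lift_definition plus_tower_closure :: "'a tower_closure \<Rightarrow> 'a tower_closure \<Rightarrow> 'a tower_closure" is "(+)"
  by (rule tower_closure_ops[simplified mem_Collect_eq])
lift_definition times_tower_closure :: "'a tower_closure \<Rightarrow> 'a tower_closure \<Rightarrow> 'a tower_closure" is "(*)"
  by (rule tower_closure_ops[simplified mem_Collect_eq])
lift_definition minus_tower_closure :: "'a tower_closure \<Rightarrow> 'a tower_closure \<Rightarrow> 'a tower_closure" is "(-)"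
  by (rule tower_closure_ops[simplified mem_Collect_eq])
lift_definition divide_tower_closure :: "'a tower_closure \<Rightarrow> 'a tower_closure \<Rightarrow> 'a tower_closure" is "(/)"
  by (rule tower_closure_ops[simplified mem_Collect_eq])
lift_definition uminus_tower_closure :: "'a tower_closure \<Rightarrow> 'a tower_closure" is uminus
  by (rule tower_closure_ops[simplified mem_Collect_eq])
lift_definition inverse_tower_closure :: "'a tower_closure \<Rightarrow> 'a tower_closure" is inverse
  by (rule tower_closure_ops[simplified mem_Collect_eq])

instance
  by standard (transfer, simp add: algebra_simps divide_inverse)+

end

interpretation Rep: closure_hom "Rep_tower_closure :: 'a::field tower_closure \<Rightarrow> 'a alg_closure"
  by standard (simp_all add: zero_tower_closure.rep_eq one_tower_closure.rep_eq
    plus_tower_closure.rep_eq times_tower_closure.rep_eq)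

text \<open>
  Only finitely many coefficients are involved, so one tower contains them all.
\<close>

lemma coeffs_in_solvable_tower:
  fixes f :: "'a::field tower_closure poly"
  obtains L where "solvable_tower 20 (range to_ac) L" "range (coeff (map_poly Rep_tower_closure f)) \<subseteq> L"
proof -
  let ?F = "map_poly Rep_tower_closure f"
  have "\<exists>L. solvable_tower 20 (range to_ac) L \<and> set (coeffs ?F) \<subseteq> L"
    by (rule solvable_tower_finite) (use Rep_tower_closure in auto)
  then obtain L :: "'a alg_closure set"
    where L: "solvable_tower 20 (range to_ac) L" "set (coeffs ?F) \<subseteq> L" by blast
  have "0 \<in> L"
    using field_closed_solvable_tower[OF L(1) field_closed_range_to_ac] by (simp add: field_closed_def)
  hence "range (coeff ?F) \<subseteq> L" using L(2) by (simp only: range_coeff insert_subset simp_thms)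
  with L(1) show thesis by (rule that)
qed

text \<open>
  A root of a polynomial over the union of all towers is adjoined to a tower that contains the
  coefficients, which gives another tower.
\<close>

interpretation tower: root_closed 20 "TYPE('a::field tower_closure)"
proof
  fix f :: "'a tower_closure poly"
  assume deg: "0 < degree f" "degree f \<le> 20"
  define F where "F = map_poly Rep_tower_closure f"
  have "degree F = degree f" by (simp add: F_def)
  then obtain a where a: "poly F a = 0" using alg_closed_imp_poly_has_root[of F] deg by auto
  obtain L where L: "solvable_tower 20 (range to_ac) L" "range (coeff F) \<subseteq> L"
    unfolding F_def by (rule coeffs_in_solvable_tower)
  have "solvable_tower 20 (range to_ac) (generate_field ring_of_type_algebra (insert a L))"
    by (rule solvable_tower.adjoin[OF L(1) _ _ L(2) a])
       (use deg \<open>degree F = degree f\<close> in auto)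
  moreover have "a \<in> generate_field ring_of_type_algebra (insert a L)"
    by (auto intro: generate_field.incl)
  ultimately obtain b where b: "a = Rep_tower_closure b"
    using Abs_tower_closure_inverse by (metis (mono_tags, lifting) mem_Collect_eq)
  have "Rep_tower_closure (poly f b) = 0" using a unfolding b F_def by simp
  thus "\<exists>x. poly f x = 0" by (intro exI[of _ b]) simp
qed simp

section \<open>The transformation\<close>

interpretation tower: form_space 20 "TYPE('a::field tower_closure)"
  "smult :: 'a tower_closure \<Rightarrow> _" Rep_tower_closure
  by standard (simp_all add: smult_add_right smult_add_left)

theorem mainTheorem1:
  fixes p :: "'a::field poly" and n :: nat
  assumes "n \<ge> 21"
    and "Polynomial.degree p = n"
    and "Polynomial.lead_coeff p = 1"
  shows "\<exists>(L :: 'a alg_closure set) (T :: 'a alg_closure poly).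
           solvable_tower 20 (range to_ac) L \<and>
           range (Polynomial.coeff T) \<subseteq> L \<and>
           T \<noteq> 0 \<and> Polynomial.degree T \<le> n - 1 \<and>
           (\<forall>i\<in>{1..5}. Polynomial.coeff (tschirnhaus T p) (n - i) = 0)"
proof -
  let ?rep = "Rep_tower_closure :: 'a tower_closure \<Rightarrow> 'a alg_closure"
  let ?M = "map_poly ?rep"
  have base: "solvable_tower 20 (range to_ac) (range (to_ac :: 'a \<Rightarrow> _))" by (rule solvable_tower.base)
  define \<iota> :: "'a \<Rightarrow> 'a tower_closure" where "\<iota> x = Abs_tower_closure (to_ac x)" for x
  have \<iota>: "?rep (\<iota> x) = to_ac x" for x
    unfolding \<iota>_def by (rule Abs_tower_closure_inverse) (use base in blast)
  have \<iota>0: "\<iota> 0 = 0"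
    using \<iota>[of 0] by (metis Rep.hom_0_iff to_ac_0)
  define q where "q = map_poly \<iota> p"
  have Mq: "?M q = map_poly to_ac p"
    by (rule poly_eqI) (simp add: q_def coeff_map_poly \<iota>0 \<iota>)
  have degq: "degree (map_poly to_ac p) = n"
    using assms by (subst degree_map_poly) auto
  hence "q \<noteq> 0" using Mq assms(1) by auto
  define R where "R = proots (map_poly to_ac p)"
  have size_R: "size R = n" unfolding R_def by (simp add: size_proots_alg_closed degq)
  define E where "E i T = coeff (tschirnhaus (?M T) p) (n - i)" for i and T :: "'a tower_closure poly"
  have E_range: "E i T \<in> range ?rep" for i T
    unfolding E_def tschirnhaus_def Mq[symmetric]
    by (rule Rep.coeff_prod_roots_in_range[OF \<open>q \<noteq> 0\<close> tower.infinite_field])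
  have E_form: "tower.form i (E i)" if "i \<le> n" for i
  proof -
    have "tower.form i (\<lambda>T. coeff (\<Prod>x\<in>#R. [:- poly (?M T) x, 1:]) (size R - i))"
      by (rule tower.form_coeff_prod)
         (use that in \<open>auto simp: size_R Rep.hom_poly.hom_add Rep.map_poly_hom_smult\<close>)
    thus ?thesis unfolding E_def[abs_def] tschirnhaus_def R_def[symmetric] size_R .
  qed
  define e where "e i T = the_inv ?rep (E i T)" for i T
  have rep_e: "?rep (e i T) = E i T" for i T
    unfolding e_def by (rule f_the_inv_into_f[OF _ E_range]) (auto simp: inj_def Rep_tower_closure_inject)
  have e_kform: "tower.kform i (e i)" if "i \<le> n" for i
    unfolding tower.kform_def rep_e using E_form[OF that] by simp
  define S where "S = {T :: 'a tower_closure poly. degree T < n}"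
  have S: "tower.subspace S"
    unfolding tower.subspace_def S_def using assms(1)
    by (auto intro: degree_add_less le_less_trans[OF degree_smult_le])
  have dim: "tower.dim_ge S n"
    unfolding tower.dim_ge_def
  proof (intro exI[of _ "monom 1 ` {..<n}"] conjI)
    show "monom 1 ` {..<n} \<subseteq> S" using assms(1) by (auto simp: S_def degree_monom_eq)
    have inj: "inj_on (monom (1 :: 'a tower_closure)) {..<n}"
      by (auto simp: inj_on_def monom_eq_iff')
    show "card (monom (1 :: 'a tower_closure) ` {..<n}) = n" using card_image[OF inj] by simp
    show "tower.independent (monom (1 :: 'a tower_closure) ` {..<n})"
    proof (rule tower.independent_if_scalars_zero)
      fix f :: "'a tower_closure poly \<Rightarrow> 'a tower_closure" and x :: "'a tower_closure poly"
      assume sum: "(\<Sum>x\<in>monom 1 ` {..<n}. smult (f x) x) = 0" and "x \<in> monom 1 ` {..<n}"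
      then obtain i where i: "i < n" "x = monom 1 i" by auto
      have "0 = coeff (\<Sum>x\<in>monom 1 ` {..<n}. smult (f x) x) i" using sum by simp
      also have "\<dots> = coeff (\<Sum>j<n. monom (f (monom 1 j)) j) i"
        by (simp add: sum.reindex[OF inj] smult_monom)
      also have "\<dots> = f x" using i by (simp add: coeff_sum)
      finally show "f x = 0" by simp
    qed simp
  qed simp
  define \<Phi> where "\<Phi> = image_mset (\<lambda>i. (i, e i)) {#1, 2, 3, 4, 5#}"
  have "tower.solvable TYPE('a) {#1, 2, 3, 4, 5#} 1 n"
    by (rule tower.solvable_mono[OF tower.solvable_1_to_5]) (use assms(1) in simp_all)
  moreover have "image_mset fst \<Phi> = {#1, 2, 3, 4, 5#}" by (simp add: \<Phi>_def)
  moreover have "tower.kform d g" if "(d, g) \<in># \<Phi>" for d g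
    using that e_kform assms(1) by (auto simp: \<Phi>_def)
  ultimately obtain B where B: "B \<subseteq> S" "tower.independent B" "card B = 1" "tower.vanishes \<Phi> (tower.span B)"
    using S dim tower.solvableD by metis
  obtain T where T: "B = {T}" using B(3) by (auto simp: card_1_singleton_iff)
  have "T \<noteq> 0" using B(2) T by auto
  have "degree T < n" using B(1) T by (simp add: S_def)
  have "\<forall>u\<in>tower.span B. e i u = 0" if "i \<in> {1..5}" for i
  proof -
    have "i = 1 \<or> i = 2 \<or> i = 3 \<or> i = 4 \<or> i = 5" using that by auto
    hence "i \<in># {#1, 2, 3, 4, 5#}" by auto
    hence "(i, e i) \<in># \<Phi>" unfolding \<Phi>_def set_image_mset by (rule imageI)
    thus ?thesis using B(4) unfolding tower.vanishes_def by auto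
  qed
  hence e0: "e i T = 0" if "i \<in> {1..5}" for i
    using that tower.span_base[of T B] T by blast
  obtain L where L: "solvable_tower 20 (range to_ac) L" "range (coeff (?M T)) \<subseteq> L"
    by (rule coeffs_in_solvable_tower)
  have "coeff (tschirnhaus (?M T) p) (n - i) = 0" if "i \<in> {1..5}" for i
    using rep_e[of i T] e0[OF that] by (simp add: E_def)
  thus ?thesis
    using L \<open>T \<noteq> 0\<close> \<open>degree T < n\<close> by (intro exI[of _ L] exI[of _ "?M T"]) auto
qed

end
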